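(* Let $k>0$ and let $P\in\mathcal P_2(\mathbb R)$ have a smooth, strictly positive density. Let $Q^\star$ be a minimizer over $\mathcal P_2(\mathbb R)$ of $J(Q)=k^2W_2^2(P,Q)+\operatorname{mmse}(Q)$, and assume that $Q^\star$ is absolutely continuous with a density $q^\star$ that is smooth and strictly positive on its support, which is an interval. Let $p_Z^\star=Q^\star*\phi$, $s^\star=(\log p_Z^\star)'$, $m^\star(z)=\mathbb E[Y\mid Y+N=z]$ for independent $Y\sim Q^\star$, $N\sim\mathcal N(0,1)$, $a^\star(y)=\int m^\star(z)\phi(z-y)\,dz$, $b^\star(y)=\int m^\star(z)^2\phi(z-y)\,dz$, $T^\star=F_P^{-1}\circ F_{Q^\star}$, and let $\varphi^\star$ be a Kantorovich potential for the quadratic-cost transport from $Q^\star$ to $P$. Then there is a constant $\lambda\in\mathbb R$ such that $$\Lambda^\star(y):=2k^2\varphi^\star(y)+y^2-2y\,a^\star(y)+b^\star(y)$$ satisfies $$\Lambda^\star(y)=\lambda\ \ \text{for }Q^\star\text{-a.e. }y,\qquad \Lambda^\star(y)\ge\lambda\ \ \text{for Lebesgue-a.e. }y.$$ On the interval $\operatorname{supp}Q^\star$ equality holds throughout, and for all $y$ with $q^\star(y)>0$, $$2k^2\bigl(y-T^\star(y)\bigr)+\frac{d}{dy}\Bigl[\bigl(2s^{\star\prime}+(s^\star)^2\bigr)*\phi\Bigr](y)=0,$$ or equivalently $$2k^2\bigl(y-T^\star(y)\bigr)+\frac{d}{dy}\Bigl(y^2-2y\,a^\star(y)+b^\star(y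)\Bigr)=0.$$
   Context: $\phi$ is the standard normal density, and $(Q*\phi)(z)=\int\phi(z-y)\,Q(dy)$. $\mathcal P_2(\mathbb R)$ is the set of Borel probability measures on $\mathbb R$ with finite second moment. $W_2^2(P,Q)=\inf_\pi\int(x-y)^2\,\pi(dx,dy)$ over couplings $\pi$ of $P$ and $Q$. $\operatorname{mmse}(Q)=\mathbb E[\operatorname{Var}(Y\mid Y+N)]$ for independent $Y\sim Q$, $N\sim\mathcal N(0,1)$. $F_\mu$ is the cumulative distribution function of $\mu$ and $F_\mu^{-1}$ its quantile function. A Kantorovich potential $\varphi_Q$ from $Q$ to $P$ is a $c$-concave function for the cost $c(x,y)=\tfrac12(x-y)^2$ with $\tfrac12W_2^2(P,Q)=\int\varphi_Q\,dQ+\int\varphi_Q^c\,dP$, where $\varphi^c(x)=\inf_y\{c(x,y)-\varphi(y)\}$; in one dimension $\varphi_Q'(y)=y-F_P^{-1}(F_Q(y))$ for $Q$-a.e. $y$. *)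

theory Defs
  imports "HOL-Probability.Probability"
begin

definition P2 :: "real measure set" where
  "P2 = {Q. real_distribution Q \<and> integrable Q (\<lambda>x. x\<^sup>2)}"

definition smooth_on_open :: "real set \<Rightarrow> (real \<Rightarrow> real) \<Rightarrow> bool" where
  "smooth_on_open S f \<longleftrightarrow> open S \<and> (\<forall>n. \<forall>x\<in>S. (deriv ^^ n) f differentiable (at x))"

text \<open>A nonnegative version of the Lebesgue density, defined at every point.\<close>
definition has_density :: "real measure \<Rightarrow> (real \<Rightarrow> real) \<Rightarrow> bool" where
  "has_density Q q \<longleftrightarrow>
     q \<in> borel_measurable borel \<and> (\<forall>x. 0 \<le> q x) \<and> Q = density lborel (\<lambda>x. ennreal (q x))"

definition measure_support :: "real measure \<Rightarrow> real set" where
  "measure_support Q = {x. \<forall>U. open U \<and> x \<in> U \<longrightarrow> 0 < emeasure Q U}"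

definition quantile :: "real measure \<Rightarrow> real \<Rightarrow> real" where
  "quantile M u = Inf {x. u \<le> cdf M x}"


definition couplings :: "real measure \<Rightarrow> real measure \<Rightarrow> (real \<times> real) measure set" where
  "couplings P Q = {\<pi>. sets \<pi> = sets (borel \<Otimes>\<^sub>M borel) \<and> distr \<pi> borel fst = P \<and> distr \<pi> borel snd = Q}"

text \<open>The infimum is finite whenever both marginals have finite second moment.\<close>
definition W2_sq :: "real measure \<Rightarrow> real measure \<Rightarrow> real" where
  "W2_sq P Q = enn2real (INF \<pi>\<in>couplings P Q. \<integral>\<^sup>+ (x, y). ennreal ((x - y)\<^sup>2) \<partial>\<pi>)"

text \<open>
  Potentials take values in the extended reals: a c-concave function is never \<open>\<infinity>\<close>, but may
  be \<open>-\<infinity>\<close> at some points (not everywhere). The cost is symmetric, so one transform serves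
  both directions.
\<close>
definition c_transform :: "(real \<Rightarrow> ereal) \<Rightarrow> real \<Rightarrow> ereal" where
  "c_transform f x = (INF y. ereal ((x - y)\<^sup>2 / 2) - f y)"

definition c_concave :: "(real \<Rightarrow> ereal) \<Rightarrow> bool" where
  "c_concave f \<longleftrightarrow> (\<exists>g. f = c_transform g) \<and> (\<forall>y. f y \<noteq> \<infinity>) \<and> (\<exists>y. f y \<noteq> - \<infinity>)"

text \<open>
  The finiteness and integrability clauses say that the two extended-real integrals in the
  duality identity exist and are finite. They follow from the identity itself, since
  \<open>f y + c_transform f x \<le> (x - y)\<^sup>2 / 2\<close> bounds both functions from above by quadratics.
\<close>
definition kantorovich_potential ::
  "real measure \<Rightarrow> real measure \<Rightarrow> (real \<Rightarrow> ereal) \<Rightarrow> bool" where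
  "kantorovich_potential Q P f \<longleftrightarrow>
     c_concave f \<and>
     (AE y in Q. \<bar>f y\<bar> \<noteq> \<infinity>) \<and> integrable Q (\<lambda>y. real_of_ereal (f y)) \<and>
     (AE x in P. \<bar>c_transform f x\<bar> \<noteq> \<infinity>) \<and> integrable P (\<lambda>x. real_of_ereal (c_transform f x)) \<and>
     W2_sq P Q / 2 = (\<integral>y. real_of_ereal (f y) \<partial>Q) + (\<integral>x. real_of_ereal (c_transform f x) \<partial>P)"


text \<open>
  Joint law of independent \<open>Y \<sim> Q\<close> and \<open>N \<sim> N(0,1)\<close>; the coordinates are \<open>Y = fst\<close> and
  \<open>N = snd\<close>. Conditioning on \<open>Y + N\<close> is conditioning on the \<open>\<sigma>\<close>-algebra it generates.
\<close>
definition joint_law :: "real measure \<Rightarrow> (real \<times> real) measure" where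
  "joint_law Q = Q \<Otimes>\<^sub>M density lborel (\<lambda>x. ennreal (std_normal_density x))"

definition cond_exp_obs ::
  "real measure \<Rightarrow> (real \<times> real \<Rightarrow> real) \<Rightarrow> real \<times> real \<Rightarrow> real" where
  "cond_exp_obs Q = real_cond_exp (joint_law Q)
     (vimage_algebra (space (joint_law Q)) (\<lambda>(y, n). y + n) borel)"

definition cond_var_obs ::
  "real measure \<Rightarrow> (real \<times> real \<Rightarrow> real) \<Rightarrow> real \<times> real \<Rightarrow> real" where
  "cond_var_obs Q X = cond_exp_obs Q (\<lambda>w. (X w - cond_exp_obs Q X w)\<^sup>2)"

definition mmse :: "real measure \<Rightarrow> real" where
  "mmse Q = (\<integral>w. cond_var_obs Q fst w \<partial>joint_law Q)"

text \<open>
  \<open>m\<close> is a version of \<open>z \<mapsto> E[Y | Y + N = z]\<close>. The law of \<open>Y + N\<close> has a positive density, so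
  \<open>m\<close> is unique up to a Lebesgue-null set.
\<close>
definition posterior_mean :: "real measure \<Rightarrow> (real \<Rightarrow> real) \<Rightarrow> bool" where
  "posterior_mean Q m \<longleftrightarrow>
     m \<in> borel_measurable borel \<and> (AE (y, n) in joint_law Q. cond_exp_obs Q fst (y, n) = m (y + n))"

definition J :: "real \<Rightarrow> real measure \<Rightarrow> real measure \<Rightarrow> real" where
  "J k P Q = k\<^sup>2 * W2_sq P Q + mmse Q"


text \<open>\<open>conv_measure Q\<close> is the Lebesgue density of the law of \<open>Y + N\<close>, not a measure.\<close>
definition conv_measure :: "real measure \<Rightarrow> real \<Rightarrow> real" where
  "conv_measure Q z = (\<integral>y. std_normal_density (z - y) \<partial>Q)"

definition conv_fun :: "(real \<Rightarrow> real) \<Rightarrow> real \<Rightarrow> real" where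
  "conv_fun f y = (\<integral>z. f z * std_normal_density (y - z) \<partial>lborel)"

end

theory Submission
  imports Defs
begin

text \<open>
  Let \<open>\<gamma>\<close> be the standard normal density and \<open>s\<close> the score of the law of \<open>Y + N\<close>. By Tweedie's formula \<open>z + s z\<close> is the posterior mean,
  so \<open>risk y = \<integral>(n + s (y + n))\<^sup>2 \<gamma>(n) dn\<close> equals \<open>y\<^sup>2 - 2 y a(y) + b(y)\<close>, and \<open>mmse R \<le> \<integral>risk dR\<close> for
  every \<open>R\<close>, with equality at \<open>R = Q\<close>. Also \<open>W\<^sub>2\<^sup>2(P, Q) = \<integral>(T y - y)\<^sup>2 dQ\<close>, while \<open>W\<^sub>2\<^sup>2(P, R)\<close> is at most
  the cost of the transported coupling when \<open>R\<close> is a pushforward of \<open>Q\<close>. Pushing the mass of a short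
  interval to either side therefore yields \<open>2k\<^sup>2(y - T y) + risk' y = 0\<close> on the interior of the support.

  Since \<open>|s z|\<^sup>2 \<le> \<integral>(z - y)\<^sup>2 dQ\<close>, the function \<open>risk'\<close> is continuous on the whole line. A finite
  endpoint of the support would thus keep \<open>T\<close> bounded near it, although \<open>T\<close> is onto because \<open>P\<close> charges
  every interval; hence the support of \<open>Q\<close> is the whole line. A Kantorovich potential has derivative
  \<open>y - T y\<close>, so the Euler--Lagrange equation says that \<open>2k\<^sup>2 \<phi> + risk\<close> has derivative 0.
  Stein's identity gives \<open>risk = 1 + (2s' + s\<^sup>2) * \<gamma>\<close>.
\<close>

subsection \<open>Differentiation under the integral sign and Gaussian moments\<close>

text \<open>Dominated convergence, transferred from sequences to the filter \<open>at x0\<close>.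
  The hypotheses hold only within distance 1 of \<open>x0\<close>, so each sequence is first shifted
  past the index \<open>N\<close> from which it stays that close.\<close>

lemma tendsto_integral_dominated_at:
  fixes f :: "real \<Rightarrow> 'a \<Rightarrow> real"
  assumes meas: "\<And>x. x \<noteq> x0 \<Longrightarrow> \<bar>x - x0\<bar> < 1 \<Longrightarrow> f x \<in> borel_measurable M"
    and g: "g \<in> borel_measurable M"
    and lim: "\<And>y. ((\<lambda>x. f x y) \<longlongrightarrow> g y) (at x0)"
    and bound: "\<And>x y. x \<noteq> x0 \<Longrightarrow> \<bar>x - x0\<bar> < 1 \<Longrightarrow> \<bar>f x y\<bar> \<le> w y"
    and w: "integrable M w"
  shows "((\<lambda>x. \<integral>y. f x y \<partial>M) \<longlongrightarrow> (\<integral>y. g y \<partial>M)) (at x0)"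
  unfolding tendsto_at_iff_sequentially comp_def
proof (intro allI impI)
  fix X :: "nat \<Rightarrow> real"
  assume X: "\<forall>i. X i \<in> UNIV - {x0}" "X \<longlonglongrightarrow> x0"
  then obtain N where N: "\<And>n. n \<ge> N \<Longrightarrow> \<bar>X n - x0\<bar> < 1"
    using LIMSEQ_D[OF X(2), of 1] by auto
  have "(\<lambda>i. \<integral>y. f (X (i + N)) y \<partial>M) \<longlonglongrightarrow> (\<integral>y. g y \<partial>M)"
  proof (rule integral_dominated_convergence[OF g _ w])
    show "f (X (i + N)) \<in> borel_measurable M" for i
      using X N by (intro meas) auto
    show "AE y in M. (\<lambda>i. f (X (i + N)) y) \<longlonglongrightarrow> g y"
    proof (rule AE_I2)
      fix y
      have "(\<lambda>i. f (X i) y) \<longlonglongrightarrow> g y"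
        using lim[of y] X unfolding tendsto_at_iff_sequentially comp_def by blast
      then show "(\<lambda>i. f (X (i + N)) y) \<longlonglongrightarrow> g y"
        by (rule LIMSEQ_ignore_initial_segment)
    qed
    show "AE y in M. norm (f (X (i + N)) y) \<le> w y" for i
      using X N bound[of "X (i + N)"] by (intro AE_I2) auto
  qed
  then show "(\<lambda>i. \<integral>y. f (X i) y \<partial>M) \<longlonglongrightarrow> (\<integral>y. g y \<partial>M)"
    by (rule LIMSEQ_offset)
qed

text \<open>By the mean value inequality the bound \<open>w\<close> on the derivative also bounds
  the difference quotients, which makes dominated convergence applicable to them.\<close>

lemma has_real_derivative_integral:
  fixes f f' :: "real \<Rightarrow> 'a \<Rightarrow> real"
  assumes int: "\<And>x. \<bar>x - x0\<bar> < 1 \<Longrightarrow> integrable M (f x)"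
    and der: "\<And>x y. \<bar>x - x0\<bar> < 1 \<Longrightarrow> ((\<lambda>x. f x y) has_real_derivative f' x y) (at x)"
    and bound: "\<And>x y. \<bar>x - x0\<bar> < 1 \<Longrightarrow> \<bar>f' x y\<bar> \<le> w y"
    and w: "integrable M w"
    and meas: "f' x0 \<in> borel_measurable M"
  shows "((\<lambda>x. \<integral>y. f x y \<partial>M) has_real_derivative (\<integral>y. f' x0 y \<partial>M)) (at x0)"
  unfolding has_field_derivative_iff
proof -
  have "((\<lambda>x. \<integral>y. (f x y - f x0 y) / (x - x0) \<partial>M) \<longlongrightarrow> (\<integral>y. f' x0 y \<partial>M)) (at x0)"
  proof (rule tendsto_integral_dominated_at[OF _ meas _ _ w])
    fix x assume x: "x \<noteq> x0" "\<bar>x - x0\<bar> < 1"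
    show "(\<lambda>y. (f x y - f x0 y) / (x - x0)) \<in> borel_measurable M"
      using int[of x] int[of x0] x by simp
    fix y
    have "norm (f x y - f x0 y) \<le> w y * norm (x - x0)"
      using x by (intro field_differentiable_bound[of "ball x0 1" "\<lambda>x. f x y" "\<lambda>x. f' x y"])
        (auto simp: dist_real_def abs_minus_commute intro!: has_field_derivative_at_within[OF der] bound)
    then show "\<bar>(f x y - f x0 y) / (x - x0)\<bar> \<le> w y"
      using x by (simp add: field_simps)
  next
    show "((\<lambda>x. (f x y - f x0 y) / (x - x0)) \<longlongrightarrow> f' x0 y) (at x0)" for y
      using der[of x0 y] by (simp add: has_field_derivative_iff)
  qed
  moreover have "\<forall>\<^sub>F x in at x0. (\<integral>y. (f x y - f x0 y) / (x - x0) \<partial>M) =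
      ((\<integral>y. f x y \<partial>M) - (\<integral>y. f x0 y \<partial>M)) / (x - x0)"
    using eventually_at_ball[OF zero_less_one, of x0 UNIV]
  proof (rule eventually_mono)
    fix x assume "x \<in> ball x0 1 \<and> x \<in> UNIV"
    then show "(\<integral>y. (f x y - f x0 y) / (x - x0) \<partial>M) =
        ((\<integral>y. f x y \<partial>M) - (\<integral>y. f x0 y \<partial>M)) / (x - x0)"
      using int[of x] int[of x0] by (simp add: dist_real_def abs_minus_commute)
  qed
  ultimately show "((\<lambda>x. ((\<integral>y. f x y \<partial>M) - (\<integral>y. f x0 y \<partial>M)) / (x - x0)) \<longlongrightarrow>
      (\<integral>y. f' x0 y \<partial>M)) (at x0)"
    by (rule Lim_transform_eventually)
qed

section \<open>Moments and integrability under the standard normal law\<close>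

abbreviation std_normal_law :: "real measure" where
  "std_normal_law \<equiv> density lborel (\<lambda>x. ennreal (std_normal_density x))"

lemma prob_space_std_normal_law: "prob_space std_normal_law"
  by (rule prob_space_normal_density) simp

lemma integrable_std_normal_law_iff:
  fixes f :: "real \<Rightarrow> real"
  assumes "f \<in> borel_measurable borel"
  shows "integrable std_normal_law f \<longleftrightarrow> integrable lborel (\<lambda>x. f x * std_normal_density x)"
  using assms by (subst integrable_density) (auto simp: mult.commute)

lemma integral_std_normal_law:
  fixes f :: "real \<Rightarrow> real"
  assumes "f \<in> borel_measurable borel"
  shows "(\<integral>x. f x \<partial>std_normal_law) = (\<integral>x. f x * std_normal_density x \<partial>lborel)"
  using assms by (subst integral_density) (auto simp: mult.commute)

text \<open>The binomial theorem reduces this to absolute moments. Such powers serve as the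
  majorants for dominated convergence below.\<close>

lemma integrable_std_normal_law_abs_power:
  "integrable std_normal_law (\<lambda>n. (r + \<bar>n\<bar>) ^ k)"
proof -
  have "(\<lambda>n::real. (r + \<bar>n\<bar>) ^ k) = (\<lambda>n. \<Sum>i\<le>k. real (k choose i) * r ^ i * \<bar>n\<bar> ^ (k - i))"
    by (simp add: binomial_ring fun_eq_iff)
  moreover have "integrable std_normal_law (\<lambda>n. \<bar>n\<bar> ^ i)" for i
    using integrable_std_normal_moment_abs[of i]
    by (subst integrable_std_normal_law_iff) (auto simp: mult.commute)
  ultimately show ?thesis
    by (auto intro!: Bochner_Integration.integrable_sum)
qed

lemma std_normal_law_second_moment: "(\<integral>n. n\<^sup>2 \<partial>std_normal_law) = 1"
  using integral_std_normal_moment_even[of 1]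
  by (subst integral_std_normal_law) (auto simp: mult.commute)

lemma integral_translate:
  fixes f :: "real \<Rightarrow> real"
  assumes [measurable]: "f \<in> borel_measurable borel"
  shows "(\<integral>z. f z * std_normal_density (z - y) \<partial>lborel) = (\<integral>n. f (y + n) \<partial>std_normal_law)"
proof -
  have "(\<integral>z. f z * std_normal_density (z - y) \<partial>lborel) =
      (\<integral>n. f (y + n) * std_normal_density n \<partial>lborel)"
    using lborel_integral_real_affine[of 1 "\<lambda>z. f z * std_normal_density (z - y)" y] by simp
  then show ?thesis
    by (subst integral_std_normal_law) auto
qed

section \<open>Uniform bounds for the normal density and growth estimates\<close>

lemma std_normal_density_le_1: "std_normal_density x \<le> 1"
proof -
  have "sqrt (2 * pi) \<ge> 1" using pi_gt3 by (simp add: real_le_rsqrt)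
  then have "1 / sqrt (2 * pi) * exp (- x\<^sup>2 / 2) \<le> 1 * 1"
    by (intro mult_mono) auto
  then show ?thesis by (simp add: std_normal_density_def)
qed

text \<open>Comes from \<open>1 + t \<le> exp t\<close> at half the square of \<open>x\<close>. Only
  uniformity matters; the constant is not sharp.\<close>

lemma square_mult_std_normal_density_le: "x\<^sup>2 * std_normal_density x \<le> 2"
proof -
  have 1: "1 + x\<^sup>2 / 2 \<le> exp (x\<^sup>2 / 2)" by (rule exp_ge_add_one_self)
  have "x\<^sup>2 * exp (- x\<^sup>2 / 2) \<le> 2"
    using 1 by (simp add: exp_minus field_simps)
  moreover have "sqrt (2 * pi) \<ge> 1" using pi_gt3 by (simp add: real_le_rsqrt)
  ultimately have "1 / sqrt (2 * pi) * (x\<^sup>2 * exp (- x\<^sup>2 / 2)) \<le> 1 * 2"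
    by (intro mult_mono) auto
  then show ?thesis by (simp add: std_normal_density_def mult_ac)
qed

lemma DERIV_std_normal_density:
  "(std_normal_density has_real_derivative - x * std_normal_density x) (at x)"
  unfolding std_normal_density_def[abs_def]
  by (auto intro!: derivative_eq_intros simp: field_simps)

lemma std_normal_density_pos: "0 < std_normal_density x"
  by (rule normal_density_pos) simp

lemma std_normal_density_minus: "std_normal_density (x - y) = std_normal_density (y - x)"
  by (simp add: std_normal_density_def power2_commute)

lemma abs_mult_std_normal_density_le: "\<bar>x * std_normal_density x\<bar> \<le> 3"
proof -
  have "\<bar>x\<bar> \<le> 1 + x\<^sup>2"
    using zero_le_power2[of "\<bar>x\<bar> - 1"] zero_le_power2[of x] unfolding power2_diff by simp
  then have "\<bar>x * std_normal_density x\<bar> \<le> (1 + x\<^sup>2) * std_normal_density x"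
    by (simp add: abs_mult mult_right_mono)
  also have "\<dots> \<le> 3"
    using std_normal_density_le_1[of x] square_mult_std_normal_density_le[of x]
    by (simp add: algebra_simps)
  finally show ?thesis .
qed

lemma abs_hermite_std_normal_density_le: "\<bar>(x\<^sup>2 - 1) * std_normal_density x\<bar> \<le> 2"
proof -
  have "0 \<le> std_normal_density x" "0 \<le> x\<^sup>2 * std_normal_density x" by simp_all
  then show ?thesis
    using std_normal_density_le_1[of x] square_mult_std_normal_density_le[of x]
    unfolding left_diff_distrib mult_1 by linarith
qed

text \<open>The square of a sum of three terms is at most three times the sum of their squares. The
  bound has the shape of the majorant in \<open>integrable_joint_law\<close>.\<close>

lemma linear_growth_mult_le:
  fixes u v y n C D :: real
  assumes "\<bar>u\<bar> \<le> C * (1 + \<bar>y\<bar> + \<bar>n\<bar>)" "\<bar>v\<bar> \<le> D * (1 + \<bar>y\<bar> + \<bar>n\<bar>)"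
  shows "\<bar>u * v\<bar> \<le> 3 * (C * D) * (1 + y\<^sup>2 + n\<^sup>2)"
proof -
  let ?r = "1 + \<bar>y\<bar> + \<bar>n\<bar>"
  have r: "?r > 0" by linarith
  have C: "C \<ge> 0" and D: "D \<ge> 0"
    using order_trans[OF abs_ge_zero assms(1)] order_trans[OF abs_ge_zero assms(2)] r
    by (simp_all add: zero_le_mult_iff)
  have "\<bar>u * v\<bar> \<le> (C * ?r) * (D * ?r)"
    unfolding abs_mult using assms C D by (intro mult_mono) auto
  also have "\<dots> = C * D * ?r\<^sup>2" by (simp add: power2_eq_square)
  also have "\<dots> \<le> C * D * (3 * (1 + y\<^sup>2 + n\<^sup>2))"
  proof (rule mult_left_mono)
    have "0 \<le> (1 - \<bar>y\<bar>)\<^sup>2 + (1 - \<bar>n\<bar>)\<^sup>2 + (\<bar>y\<bar> - \<bar>n\<bar>)\<^sup>2" by simp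
    then show "?r\<^sup>2 \<le> 3 * (1 + y\<^sup>2 + n\<^sup>2)"
      unfolding power2_diff by (simp add: power2_eq_square algebra_simps)
  qed (use C D in auto)
  also have "\<dots> = 3 * (C * D) * (1 + y\<^sup>2 + n\<^sup>2)" by (simp only: mult_ac)
  finally show ?thesis .
qed

lemma linear_growth_shift:
  fixes h :: "real \<Rightarrow> real"
  assumes "\<And>z. \<bar>h z\<bar> \<le> C * (1 + \<bar>z\<bar>)"
  shows "\<bar>h (y + n)\<bar> \<le> C * (1 + \<bar>y\<bar> + \<bar>n\<bar>)"
proof -
  have "C \<ge> 0" using order_trans[OF abs_ge_zero assms[of 0]] by simp
  then have "C * (1 + \<bar>y + n\<bar>) \<le> C * (1 + \<bar>y\<bar> + \<bar>n\<bar>)"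
    by (intro mult_left_mono) auto
  with assms[of "y + n"] show ?thesis by linarith
qed

lemma integrable_std_normal_law_bounded:
  fixes f :: "real \<Rightarrow> real"
  assumes "f \<in> borel_measurable borel" "\<And>n. \<bar>f n\<bar> \<le> C * (r + \<bar>n\<bar>) ^ k"
  shows "integrable std_normal_law f"
proof (rule Bochner_Integration.integrable_bound)
  show "integrable std_normal_law (\<lambda>n. C * (r + \<bar>n\<bar>) ^ k)"
    by (intro integrable_mult_right integrable_std_normal_law_abs_power)
  show "AE n in std_normal_law. norm (f n) \<le> norm (C * (r + \<bar>n\<bar>) ^ k)"
    using assms(2) by (intro AE_I2) (metis abs_ge_self order_trans real_norm_def)
qed (use assms(1) in simp)

subsection \<open>The score of a Gaussian mixture\<close>

text \<open>Membership in \<open>P2\<close> as a locale, so that the results apply alike to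
  \<open>P\<close>, to \<open>Q\<close> and to perturbations of \<open>Q\<close>.\<close>

locale second_moment_law = real_distribution M for M :: "real measure" +
  assumes sq_integrable: "integrable M (\<lambda>x. x\<^sup>2)"
begin

lemma prob_UNIV: "prob UNIV = 1"
  using prob_space by simp

lemma id_integrable: "integrable M (\<lambda>x. x)"
  using sq_integrable by (rule square_integrable_imp_integrable[rotated]) simp

lemma integrable_sq_diff: "integrable M (\<lambda>y. (z - y)\<^sup>2)"
  using id_integrable sq_integrable by (simp add: power2_diff)

definition spread :: "real \<Rightarrow> real" where
  "spread z = (\<integral>y. (z - y)\<^sup>2 \<partial>M)"

text \<open>Large enough for \<open>spread_le\<close>, and at least 1, so that it is dominated by
  its own square.\<close>

definition growth :: real where
  "growth = 2 * (1 + (\<integral>y. y\<^sup>2 \<partial>M))"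

lemma growth_ge_1: "growth \<ge> 1"
proof -
  have "(\<integral>y. y\<^sup>2 \<partial>M) \<ge> 0" by simp
  then show ?thesis unfolding growth_def by (simp only: distrib_left)
qed

lemma spread_le: "spread z \<le> growth * (1 + \<bar>z\<bar>)\<^sup>2"
proof -
  have pos: "(\<integral>y. y\<^sup>2 \<partial>M) \<ge> 0" by simp
  have "spread z \<le> (\<integral>y. 2 * z\<^sup>2 + 2 * y\<^sup>2 \<partial>M)"
    unfolding spread_def
  proof (rule integral_mono)
    show "(z - y)\<^sup>2 \<le> 2 * z\<^sup>2 + 2 * y\<^sup>2" for y
      using zero_le_power2[of "z + y"] by (simp add: power2_eq_square algebra_simps)
  qed (use integrable_sq_diff sq_integrable in auto)
  also have "\<dots> = 2 * z\<^sup>2 + 2 * (\<integral>y. y\<^sup>2 \<partial>M)"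
    using sq_integrable by (subst Bochner_Integration.integral_add) (auto simp: prob_UNIV)
  also have "\<dots> \<le> growth * 1 + growth * z\<^sup>2"
    using pos mult_nonneg_nonneg[OF pos zero_le_power2[of z]]
    unfolding growth_def by (simp add: algebra_simps)
  also have "\<dots> \<le> growth * (1 + \<bar>z\<bar>)\<^sup>2"
    using growth_ge_1 unfolding distrib_left[symmetric]
    by (intro mult_left_mono) (auto simp: power2_eq_square algebra_simps)
  finally show ?thesis .
qed

section \<open>The mixture density and its first two derivatives\<close>

definition p0 :: "real \<Rightarrow> real" where
  "p0 z = (\<integral>y. std_normal_density (z - y) \<partial>M)"

definition p1 :: "real \<Rightarrow> real" where
  "p1 z = (\<integral>y. - (z - y) * std_normal_density (z - y) \<partial>M)"

text \<open>\<open>p1\<close> and \<open>p2\<close> come from differentiating \<open>p0\<close>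
  under the integral; the polynomial factors are, up to sign, the first two Hermite
  polynomials.\<close>

definition p2 :: "real \<Rightarrow> real" where
  "p2 z = (\<integral>y. ((z - y)\<^sup>2 - 1) * std_normal_density (z - y) \<partial>M)"

lemma integrable_p0: "integrable M (\<lambda>y. std_normal_density (z - y))"
  by (rule integrable_const_bound[where B=1]) (auto simp: std_normal_density_le_1)

lemma integrable_p1: "integrable M (\<lambda>y. - (z - y) * std_normal_density (z - y))"
proof (rule integrable_const_bound[where B=3])
  show "AE y in M. norm (- (z - y) * std_normal_density (z - y)) \<le> 3"
    using abs_mult_std_normal_density_le by (intro AE_I2) (simp only: real_norm_def mult_minus_left abs_minus)
qed simp

lemma DERIV_p0: "(p0 has_real_derivative p1 z) (at z)"
proof -
  have "((\<lambda>x. \<integral>y. std_normal_density (x - y) \<partial>M) has_real_derivative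
      (\<integral>y. - (z - y) * std_normal_density (z - y) \<partial>M)) (at z)"
  proof (rule has_real_derivative_integral[where w="\<lambda>_. 3" and
        f'="\<lambda>x y. - (x - y) * std_normal_density (x - y)"])
    show "((\<lambda>x. std_normal_density (x - y)) has_real_derivative
        - (x - y) * std_normal_density (x - y)) (at x)" for x y
      using DERIV_shift[THEN iffD1, of std_normal_density _ x "- y"]
        DERIV_std_normal_density[of "x - y"] by simp
    show "\<bar>- (x - y) * std_normal_density (x - y)\<bar> \<le> 3" for x y
      using abs_mult_std_normal_density_le[of "x - y"] by (simp only: mult_minus_left abs_minus)
  qed (use integrable_p0 in simp_all)
  then show ?thesis
    unfolding p0_def[abs_def] p1_def .
qed

lemma DERIV_p1: "(p1 has_real_derivative p2 z) (at z)"
proof -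
  have *: "((\<lambda>u. - u * std_normal_density u) has_real_derivative (u\<^sup>2 - 1) * std_normal_density u) (at u)" for u
    by (rule DERIV_cong[OF DERIV_mult[OF DERIV_minus[OF DERIV_ident] DERIV_std_normal_density]])
      (simp add: power2_eq_square algebra_simps)
  have "((\<lambda>x. \<integral>y. - (x - y) * std_normal_density (x - y) \<partial>M) has_real_derivative
      (\<integral>y. ((z - y)\<^sup>2 - 1) * std_normal_density (z - y) \<partial>M)) (at z)"
  proof (rule has_real_derivative_integral[where w="\<lambda>_. 2" and
        f'="\<lambda>x y. ((x - y)\<^sup>2 - 1) * std_normal_density (x - y)"])
    show "((\<lambda>x. - (x - y) * std_normal_density (x - y)) has_real_derivative
        ((x - y)\<^sup>2 - 1) * std_normal_density (x - y)) (at x)" for x y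
      using DERIV_shift[THEN iffD1, of "\<lambda>u. - u * std_normal_density u" _ x "- y"]
        *[of "x - y"] by simp
    show "\<bar>((x - y)\<^sup>2 - 1) * std_normal_density (x - y)\<bar> \<le> 2" for x y
      by (rule abs_hermite_std_normal_density_le)
    show "integrable M (\<lambda>y. - (x - y) * std_normal_density (x - y))" for x
      by (rule integrable_p1)
  qed simp_all
  then show ?thesis
    unfolding p1_def[abs_def] p2_def .
qed

lemma isCont_p2: "isCont p2 z"
  unfolding p2_def[abs_def] isCont_def
proof (rule tendsto_integral_dominated_at[where w="\<lambda>_. 2"])
  show "(\<lambda>x. ((x - y)\<^sup>2 - 1) * std_normal_density (x - y)) \<midarrow>z\<rightarrow>
      ((z - y)\<^sup>2 - 1) * std_normal_density (z - y)" for y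
  proof -
    have "isCont std_normal_density (z - y)" by (rule DERIV_isCont[OF DERIV_std_normal_density])
    then have "isCont (\<lambda>x. std_normal_density (x - y)) z"
      by (rule isCont_o2[where f="\<lambda>x. x - y", rotated]) simp
    then have "isCont (\<lambda>x. ((x - y)\<^sup>2 - 1) * std_normal_density (x - y)) z"
      by (intro isCont_mult isCont_diff isCont_power) auto
    then show ?thesis by (simp add: isCont_def)
  qed
  show "\<bar>((x - y)\<^sup>2 - 1) * std_normal_density (x - y)\<bar> \<le> 2" for x y
    using abs_hermite_std_normal_density_le[of "x - y"] by simp
qed auto

lemma p0_pos: "p0 z > 0"
proof -
  have "p0 z \<noteq> 0"
  proof
    assume "p0 z = 0"
    then have "AE y in M. std_normal_density (z - y) = 0"
      unfolding p0_def using integrable_p0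
      by (subst (asm) integral_nonneg_eq_0_iff_AE) auto
    then have "AE y in M. False"
      by eventually_elim (metis std_normal_density_pos less_irrefl)
    then show False by simp
  qed
  moreover have "p0 z \<ge> 0" unfolding p0_def by simp
  ultimately show ?thesis by simp
qed

lemma integrable_weighted_sq: "integrable M (\<lambda>y. (z - y)\<^sup>2 * std_normal_density (z - y))"
  by (rule integrable_const_bound[where B=2])
    (auto simp: abs_mult square_mult_std_normal_density_le)

text \<open>Chebyshev's association inequality: the weight \<open>exp (- t / 2)\<close> decreases in \<open>t = (z - y)\<^sup>2\<close>.\<close>
lemma weighted_spread_le:
  "(\<integral>y. (z - y)\<^sup>2 * std_normal_density (z - y) \<partial>M) \<le> spread z * p0 z"
proof -
  define w where "w t = 1 / sqrt (2 * pi) * exp (- t / 2)" for t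
  have w: "std_normal_density (z - y) = w ((z - y)\<^sup>2)" for y
    by (simp add: std_normal_density_def w_def)
  have anti: "(t - u) * (w t - w u) \<le> 0" for t u
  proof (cases "t \<le> u")
    case True
    then have "w u \<le> w t" unfolding w_def by (intro mult_left_mono) auto
    with True show ?thesis by (simp add: mult_nonpos_nonneg)
  next
    case False
    then have "w t \<le> w u" unfolding w_def by (intro mult_left_mono) auto
    with False show ?thesis by (simp add: mult_nonneg_nonpos)
  qed
  \<comment> \<open>Comparison with the mean \<open>spread z\<close> replaces the usual
    symmetrization over two independent copies. The terms with the constant weight
    \<open>w (spread z)\<close> cancel after integration, because \<open>spread z\<close> is the
    mean of the squared distance.\<close>
  let ?d = "\<lambda>y. ((z - y)\<^sup>2 - spread z) * (std_normal_density (z - y) - w (spread z))"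
  have eq: "?d y = (z - y)\<^sup>2 * std_normal_density (z - y) - spread z * std_normal_density (z - y)
      - (w (spread z) * (z - y)\<^sup>2 - w (spread z) * spread z)" for y
    by (simp add: algebra_simps)
  have "(\<integral>y. - ?d y \<partial>M) \<ge> 0"
    using anti by (intro integral_nonneg_AE) (auto simp: w)
  then have "(\<integral>y. ?d y \<partial>M) \<le> 0" by simp
  moreover have "(\<integral>y. ?d y \<partial>M) =
      (\<integral>y. (z - y)\<^sup>2 * std_normal_density (z - y) \<partial>M) - spread z * p0 z -
      (w (spread z) * spread z - w (spread z) * spread z)"
    unfolding eq
    using integrable_weighted_sq[of z] integrable_p0[of z] integrable_sq_diff[of z]
    by (simp add: Bochner_Integration.integral_diff p0_def spread_def prob_UNIV)
  ultimately show ?thesis by simp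
qed

section \<open>The score, its derivative and their growth\<close>

definition score :: "real \<Rightarrow> real" where
  "score z = p1 z / p0 z"

definition score' :: "real \<Rightarrow> real" where
  "score' z = p2 z / p0 z - (score z)\<^sup>2"

lemma DERIV_score: "(score has_real_derivative score' z) (at z)"
  unfolding score_def[abs_def] score'_def
  by (rule DERIV_cong[OF DERIV_divide[OF DERIV_p1 DERIV_p0]])
    (use p0_pos[of z] in \<open>simp_all add: diff_divide_distrib power2_eq_square\<close>)

lemma isCont_score: "isCont score z"
  by (rule DERIV_isCont[OF DERIV_score])

lemma isCont_score': "isCont score' z"
  unfolding score'_def[abs_def]
  using p0_pos[of z]
  by (intro isCont_diff isCont_power isCont_divide DERIV_isCont[OF DERIV_p0] isCont_p2 isCont_score) auto

lemma measurable_score[measurable]: "score \<in> borel_measurable borel"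
  using isCont_score by (intro borel_measurable_continuous_onI continuous_at_imp_continuous_on) blast

lemma measurable_score'[measurable]: "score' \<in> borel_measurable borel"
  using isCont_score' by (intro borel_measurable_continuous_onI continuous_at_imp_continuous_on) blast

text \<open>The score is the mean of \<open>y - z\<close> under the posterior weights, so its square
  is at most the posterior mean of the squared distance (a variance is nonnegative). The association
  inequality then replaces the posterior by \<open>M\<close>.\<close>

lemma score_sq_le_spread: "(score z)\<^sup>2 \<le> spread z"
proof -
  let ?\<phi> = "\<lambda>y. std_normal_density (z - y)"
  have "0 \<le> (\<integral>y. (- (z - y) - score z)\<^sup>2 * ?\<phi> y \<partial>M)"
    by simp
  also have "\<dots> = (\<integral>y. (z - y)\<^sup>2 * ?\<phi> y - 2 * score z * (- (z - y) * ?\<phi> y) + (score z)\<^sup>2 * ?\<phi> y \<partial>M)"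
    by (intro Bochner_Integration.integral_cong) (auto simp: power2_eq_square algebra_simps)
  also have "\<dots> = (\<integral>y. (z - y)\<^sup>2 * ?\<phi> y \<partial>M) - 2 * score z * p1 z + (score z)\<^sup>2 * p0 z"
    using integrable_weighted_sq[of z] integrable_p0[of z] integrable_p1[of z]
    unfolding p0_def p1_def
    by (subst Bochner_Integration.integral_add, simp, simp,
        subst Bochner_Integration.integral_diff, simp_all)
  also have "p1 z = score z * p0 z"
    using p0_pos[of z] by (simp add: score_def)
  finally have "(score z)\<^sup>2 * p0 z \<le> (\<integral>y. (z - y)\<^sup>2 * ?\<phi> y \<partial>M)"
    by (simp add: power2_eq_square algebra_simps)
  also have "\<dots> \<le> spread z * p0 z" by (rule weighted_spread_le)
  finally show ?thesis using p0_pos[of z] by simp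
qed

lemma abs_score_le: "\<bar>score z\<bar> \<le> growth * (1 + \<bar>z\<bar>)"
proof -
  have "(score z)\<^sup>2 \<le> growth * (1 + \<bar>z\<bar>)\<^sup>2"
    using score_sq_le_spread spread_le by (rule order_trans)
  also have "\<dots> \<le> growth\<^sup>2 * (1 + \<bar>z\<bar>)\<^sup>2"
    using growth_ge_1 by (intro mult_right_mono) (auto simp: power2_eq_square)
  finally have "\<bar>score z\<bar>\<^sup>2 \<le> (growth * (1 + \<bar>z\<bar>))\<^sup>2"
    by (simp add: power_mult_distrib)
  then show ?thesis
    by (rule power2_le_imp_le) (use growth_ge_1 in auto)
qed

text \<open>The quotient \<open>p2 z / p0 z\<close> is the posterior mean of the squared distance
  minus 1, which the association inequality again controls by \<open>spread z\<close>.\<close>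

lemma abs_score'_le: "\<bar>score' z\<bar> \<le> 3 * growth * (1 + \<bar>z\<bar>)\<^sup>2"
proof -
  let ?w = "\<integral>y. (z - y)\<^sup>2 * std_normal_density (z - y) \<partial>M"
  have "p2 z = ?w - p0 z"
    unfolding p2_def p0_def left_diff_distrib
    using integrable_weighted_sq[of z] integrable_p0[of z] by simp
  moreover have "0 \<le> ?w" by simp
  ultimately have "\<bar>p2 z\<bar> \<le> spread z * p0 z + p0 z"
    using weighted_spread_le[of z] p0_pos[of z] by linarith
  then have "\<bar>p2 z / p0 z\<bar> \<le> spread z + 1"
    using p0_pos[of z] by (simp add: field_simps)
  then have "\<bar>score' z\<bar> \<le> 2 * spread z + 1"
    using score_sq_le_spread[of z] zero_le_power2[of "score z"]
    unfolding score'_def by linarith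
  moreover have "1 \<le> growth * (1 + \<bar>z\<bar>)\<^sup>2"
    using mult_mono[OF growth_ge_1, of 1 "(1 + \<bar>z\<bar>)\<^sup>2"] growth_ge_1 by simp
  ultimately show ?thesis
    using spread_le[of z] by simp
qed

subsection \<open>Posterior mean and minimum mean square error\<close>

lemma sets_joint_law[measurable_cong]: "sets (joint_law M) = sets (borel \<Otimes>\<^sub>M borel)"
  unfolding joint_law_def by (intro sets_pair_measure_cong) simp_all

lemma space_joint_law: "space (joint_law M) = UNIV"
  by (simp add: joint_law_def space_pair_measure)

lemma pair_prob_space_std_normal: "pair_prob_space M std_normal_law"
  by (simp add: pair_prob_space_def pair_sigma_finite_def prob_space_std_normal_law
      prob_space_axioms prob_space_imp_sigma_finite)

lemma prob_space_joint_law: "prob_space (joint_law M)"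
proof -
  interpret pair_prob_space M std_normal_law by (rule pair_prob_space_std_normal)
  show ?thesis unfolding joint_law_def by unfold_locales
qed

lemma integrable_joint_law:
  fixes g :: "real \<times> real \<Rightarrow> real"
  assumes [measurable]: "g \<in> borel_measurable (borel \<Otimes>\<^sub>M borel)"
    and bound: "\<And>y n. \<bar>g (y, n)\<bar> \<le> C * (1 + y\<^sup>2 + n\<^sup>2)"
  shows "integrable (joint_law M) g"
proof -
  interpret N: prob_space std_normal_law by (rule prob_space_std_normal_law)
  interpret pair_prob_space M std_normal_law by (rule pair_prob_space_std_normal)
  have C: "C \<ge> 0"
    using bound[of 0 0] abs_ge_zero[of "g (0, 0)"] by simp
  have N: "integrable std_normal_law (\<lambda>n. n\<^sup>2)"
    using integrable_std_normal_law_abs_power[of 0 2] by simp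
  have "(\<integral>n. (1 + y\<^sup>2 + n\<^sup>2) \<partial>std_normal_law) = 1 + y\<^sup>2 + 1" for y
    using N N.prob_space
    by (subst Bochner_Integration.integral_add) (simp_all add: std_normal_law_second_moment)
  then have inner: "(\<integral>n. norm (1 + y\<^sup>2 + n\<^sup>2) \<partial>std_normal_law) = 1 + y\<^sup>2 + 1" for y
    by simp
  have "integrable (M \<Otimes>\<^sub>M std_normal_law) (\<lambda>w. 1 + (fst w)\<^sup>2 + (snd w)\<^sup>2)"
  proof (rule Fubini_integrable)
    show "integrable M (\<lambda>y. \<integral>n. norm (1 + (fst (y, n))\<^sup>2 + (snd (y, n))\<^sup>2) \<partial>std_normal_law)"
      unfolding fst_conv snd_conv inner using sq_integrable by simp
    show "AE y in M. integrable std_normal_law (\<lambda>n. 1 + (fst (y, n))\<^sup>2 + (snd (y, n))\<^sup>2)"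
      using N by simp
  qed simp
  then have "integrable (joint_law M) (\<lambda>w. C * (1 + (fst w)\<^sup>2 + (snd w)\<^sup>2))"
    unfolding joint_law_def by (rule integrable_mult_right)
  then show ?thesis
  proof (rule Bochner_Integration.integrable_bound)
    show "AE w in joint_law M. norm (g w) \<le> norm (C * (1 + (fst w)\<^sup>2 + (snd w)\<^sup>2))"
      using bound C by (auto simp: abs_mult intro!: AE_I2)
  qed simp
qed

text \<open>The substitution \<open>z = y + n\<close> for fixed \<open>y\<close>, with unit
  Jacobian, passes from signal and noise to signal and observation.\<close>

lemma nn_integral_joint_law_shift:
  fixes f :: "real \<times> real \<Rightarrow> ennreal"
  assumes [measurable]: "f \<in> borel_measurable (borel \<Otimes>\<^sub>M borel)"
  shows "(\<integral>\<^sup>+(y, n). f (y, y + n) \<partial>joint_law M) =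
    (\<integral>\<^sup>+(y, z). f (y, z) * ennreal (std_normal_density (z - y)) \<partial>(M \<Otimes>\<^sub>M lborel))"
proof -
  interpret N: prob_space std_normal_law by (rule prob_space_std_normal_law)
  have "(\<integral>\<^sup>+(y, n). f (y, y + n) \<partial>joint_law M) = (\<integral>\<^sup>+y. \<integral>\<^sup>+n. f (y, y + n) \<partial>std_normal_law \<partial>M)"
    unfolding joint_law_def by (subst N.nn_integral_fst[symmetric]) (simp_all add: split_beta')
  also have "\<dots> = (\<integral>\<^sup>+y. \<integral>\<^sup>+n. f (y, y + n) * ennreal (std_normal_density n) \<partial>lborel \<partial>M)"
    by (intro nn_integral_cong) (subst nn_integral_density, auto simp: mult.commute)
  also have "\<dots> = (\<integral>\<^sup>+y. \<integral>\<^sup>+z. f (y, z) * ennreal (std_normal_density (z - y)) \<partial>lborel \<partial>M)"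
  proof (rule nn_integral_cong)
    fix y
    show "(\<integral>\<^sup>+n. f (y, y + n) * ennreal (std_normal_density n) \<partial>lborel) =
        (\<integral>\<^sup>+z. f (y, z) * ennreal (std_normal_density (z - y)) \<partial>lborel)"
      using nn_integral_real_affine[of "\<lambda>z. f (y, z) * std_normal_density (z - y)" 1 y] by simp
  qed
  also have "\<dots> = (\<integral>\<^sup>+(y, z). f (y, z) * ennreal (std_normal_density (z - y)) \<partial>(M \<Otimes>\<^sub>M lborel))"
    by (subst lborel.nn_integral_fst[symmetric]) (simp_all add: split_beta')
  finally show ?thesis .
qed

lemma joint_law_shift:
  "distr (joint_law M) (borel \<Otimes>\<^sub>M borel) (\<lambda>(y, n). (y, y + n)) =
    density (M \<Otimes>\<^sub>M lborel) (\<lambda>(y, z). ennreal (std_normal_density (z - y)))"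
proof (rule measure_eqI)
  show "sets (distr (joint_law M) (borel \<Otimes>\<^sub>M borel) (\<lambda>(y, n). (y, y + n))) =
      sets (density (M \<Otimes>\<^sub>M lborel) (\<lambda>(y, z). ennreal (std_normal_density (z - y))))"
    by (simp cong: sets_pair_measure_cong)
  fix A assume "A \<in> sets (distr (joint_law M) (borel \<Otimes>\<^sub>M borel) (\<lambda>(y, n). (y, y + n)))"
  then have A[measurable]: "A \<in> sets (borel \<Otimes>\<^sub>M borel)" by simp
  have A': "A \<in> sets (M \<Otimes>\<^sub>M lborel)" by simp
  have "emeasure (distr (joint_law M) (borel \<Otimes>\<^sub>M borel) (\<lambda>(y, n). (y, y + n))) A =
      (\<integral>\<^sup>+x. indicator A x \<partial>distr (joint_law M) (borel \<Otimes>\<^sub>M borel) (\<lambda>(y, n). (y, y + n)))"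
    by (subst nn_integral_indicator) simp_all
  also have "\<dots> = (\<integral>\<^sup>+(y, n). (indicator A (y, y + n) :: ennreal) \<partial>joint_law M)"
    by (subst nn_integral_distr) (simp_all add: split_beta')
  also have "\<dots> = (\<integral>\<^sup>+(y, z). (indicator A (y, z) :: ennreal) * ennreal (std_normal_density (z - y)) \<partial>(M \<Otimes>\<^sub>M lborel))"
    by (rule nn_integral_joint_law_shift) simp
  also have "\<dots> = emeasure (density (M \<Otimes>\<^sub>M lborel) (\<lambda>(y, z). ennreal (std_normal_density (z - y)))) A"
    using A' by (subst emeasure_density) (simp_all add: split_beta' mult.commute)
  finally show "emeasure (distr (joint_law M) (borel \<Otimes>\<^sub>M borel) (\<lambda>(y, n). (y, y + n))) A =
      emeasure (density (M \<Otimes>\<^sub>M lborel) (\<lambda>(y, z). ennreal (std_normal_density (z - y)))) A" .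
qed

text \<open>The observation \<open>z\<close> is the outer variable, so that the inner integral is
  against the unnormalized posterior of the signal.\<close>

lemma integral_joint_law_shift:
  fixes f :: "real \<Rightarrow> real \<Rightarrow> real"
  assumes [measurable]: "(\<lambda>(y, z). f y z) \<in> borel_measurable (borel \<Otimes>\<^sub>M borel)"
    and int: "integrable (joint_law M) (\<lambda>(y, n). f y (y + n))"
  shows "(\<integral>(y, n). f y (y + n) \<partial>joint_law M) =
    (\<integral>z. (\<integral>y. f y z * std_normal_density (z - y) \<partial>M) \<partial>lborel)"
proof -
  interpret pair_sigma_finite M lborel
    by (simp add: pair_sigma_finite_def lborel.sigma_finite_measure_axioms sigma_finite_measure_axioms)
  let ?D = "distr (joint_law M) (borel \<Otimes>\<^sub>M borel) (\<lambda>(y, n). (y, y + n))"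
  have D: "?D = density (M \<Otimes>\<^sub>M lborel) (\<lambda>w. ennreal (std_normal_density (snd w - fst w)))"
    using joint_law_shift unfolding split_beta' .
  have [measurable]: "(\<lambda>w. f (fst w) (snd w)) \<in> borel_measurable (borel \<Otimes>\<^sub>M borel)"
    using assms(1) by (simp add: split_beta')
  have "integrable ?D (\<lambda>w. f (fst w) (snd w))"
    using int by (subst integrable_distr_eq) (simp_all add: split_beta')
  then have int': "integrable (M \<Otimes>\<^sub>M lborel) (\<lambda>w. std_normal_density (snd w - fst w) * f (fst w) (snd w))"
    unfolding D by (subst (asm) integrable_density) simp_all
  have "(\<integral>(y, n). f y (y + n) \<partial>joint_law M) = (\<integral>w. f (fst w) (snd w) \<partial>?D)"
    by (subst integral_distr) (simp_all add: split_beta')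
  also have "\<dots> = (\<integral>w. std_normal_density (snd w - fst w) * f (fst w) (snd w) \<partial>(M \<Otimes>\<^sub>M lborel))"
    unfolding D by (subst integral_density) simp_all
  also have "\<dots> = (\<integral>z. (\<integral>y. f y z * std_normal_density (z - y) \<partial>M) \<partial>lborel)"
    using integral_snd[of "\<lambda>y z. std_normal_density (z - y) * f y z"] int'
    by (simp add: mult.commute split_beta')
  finally show ?thesis .
qed

section \<open>Tweedie's formula and the optimality of the posterior mean\<close>

definition post_mean :: "real \<Rightarrow> real" where
  "post_mean z = z + score z"

lemma measurable_post_mean[measurable]: "post_mean \<in> borel_measurable borel"
  unfolding post_mean_def[abs_def] by simp

lemma abs_post_mean_le: "\<bar>post_mean z\<bar> \<le> (1 + growth) * (1 + \<bar>z\<bar>)"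
  using abs_score_le[of z] growth_ge_1 unfolding post_mean_def by (simp add: algebra_simps)

lemma weighted_mean: "(\<integral>y. y * std_normal_density (z - y) \<partial>M) = post_mean z * p0 z"
proof -
  have eq: "y * std_normal_density (z - y) =
      z * std_normal_density (z - y) + - (z - y) * std_normal_density (z - y)" for y
    by (simp add: algebra_simps)
  have "(\<integral>y. y * std_normal_density (z - y) \<partial>M) = z * p0 z + p1 z"
    unfolding eq p0_def p1_def using integrable_p0[of z] integrable_p1[of z]
    by (subst Bochner_Integration.integral_add) simp_all
  also have "p1 z = score z * p0 z"
    using p0_pos[of z] by (simp add: score_def)
  finally show ?thesis by (simp add: post_mean_def algebra_simps)
qed

text \<open>Orthogonality of the estimation error to functions of the observation: for each
  \<open>z\<close> the two inner integrals agree by \<open>weighted_mean\<close>. Linear growth of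
  \<open>h\<close> gives integrability from second moments alone.\<close>

lemma integral_obs_mult_signal:
  fixes h :: "real \<Rightarrow> real"
  assumes [measurable]: "h \<in> borel_measurable borel"
    and h: "\<And>z. \<bar>h z\<bar> \<le> C * (1 + \<bar>z\<bar>)"
  shows "integrable (joint_law M) (\<lambda>(y, n). h (y + n) * y)"
    and "integrable (joint_law M) (\<lambda>(y, n). h (y + n) * post_mean (y + n))"
    and "(\<integral>(y, n). h (y + n) * y \<partial>joint_law M) =
      (\<integral>(y, n). h (y + n) * post_mean (y + n) \<partial>joint_law M)"
proof -
  note h' = linear_growth_shift[of h C, OF h]
  note p' = linear_growth_shift[of post_mean "1 + growth", OF abs_post_mean_le]
  show 1: "integrable (joint_law M) (\<lambda>(y, n). h (y + n) * y)"
  proof (rule integrable_joint_law)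
    show "\<bar>case (y, n) of (y, n) \<Rightarrow> h (y + n) * y\<bar> \<le> 3 * (C * 1) * (1 + y\<^sup>2 + n\<^sup>2)" for y n
      unfolding prod.case by (rule linear_growth_mult_le[OF h']) simp
  qed simp
  show 2: "integrable (joint_law M) (\<lambda>(y, n). h (y + n) * post_mean (y + n))"
  proof (rule integrable_joint_law)
    show "\<bar>case (y, n) of (y, n) \<Rightarrow> h (y + n) * post_mean (y + n)\<bar>
        \<le> 3 * (C * (1 + growth)) * (1 + y\<^sup>2 + n\<^sup>2)" for y n
      unfolding prod.case by (rule linear_growth_mult_le[OF h' p'])
  qed simp
  show "(\<integral>(y, n). h (y + n) * y \<partial>joint_law M) =
      (\<integral>(y, n). h (y + n) * post_mean (y + n) \<partial>joint_law M)"
    using integral_joint_law_shift[of "\<lambda>y z. h z * y", OF _ 1]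
      integral_joint_law_shift[of "\<lambda>y z. h z * post_mean z", OF _ 2]
    by (simp add: mult.assoc weighted_mean p0_def[symmetric])
qed

abbreviation obs_algebra :: "(real \<times> real) measure" where
  "obs_algebra \<equiv> vimage_algebra (space (joint_law M)) (\<lambda>(y, n). y + n) borel"

lemma finite_measure_subalgebra_obs: "finite_measure_subalgebra (joint_law M) obs_algebra"
proof -
  interpret Jt: prob_space "joint_law M" by (rule prob_space_joint_law)
  show ?thesis
  proof
    show "subalgebra (joint_law M) obs_algebra"
      unfolding subalgebra_def by (intro conjI sets_image_in_sets) simp_all
  qed
qed

text \<open>Events of \<open>obs_algebra\<close> are preimages of Borel sets under the observation,
  so the defining property of conditional expectation is the orthogonality relation with
  \<open>h\<close> an indicator.\<close>

lemma tweedie: "AE w in joint_law M. cond_exp_obs M fst w = post_mean (fst w + snd w)"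
proof -
  interpret S: finite_measure_subalgebra "joint_law M" obs_algebra
    by (rule finite_measure_subalgebra_obs)
  have [measurable]: "(\<lambda>(y, n). y + n) \<in> measurable obs_algebra borel"
    by (rule measurable_vimage_algebra1) simp
  show ?thesis
    unfolding cond_exp_obs_def
  proof (rule S.real_cond_exp_charact)
    fix A assume "A \<in> sets obs_algebra"
    then obtain B where [measurable]: "B \<in> sets borel" and A: "A = (\<lambda>(y, n). y + n) -` B"
      by (auto simp: sets_vimage_algebra2 space_joint_law)
    have ind: "indicator A w = indicator B (fst w + snd w)" for w :: "real \<times> real"
      by (auto simp: A indicator_def split: prod.splits)
    have "\<bar>indicator B z :: real\<bar> \<le> 1 * (1 + \<bar>z\<bar>)" for z
      by (simp add: indicator_def)
    from integral_obs_mult_signal(3)[of "indicator B", OF _ this]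
    show "(\<integral>w\<in>A. fst w \<partial>joint_law M) = (\<integral>w\<in>A. post_mean (fst w + snd w) \<partial>joint_law M)"
      by (simp add: set_lebesgue_integral_def ind split_beta')
  next
    have "\<bar>(\<lambda>_. 1) z :: real\<bar> \<le> 1 * (1 + \<bar>z\<bar>)" for z :: real by simp
    from integral_obs_mult_signal(1,2)[of "\<lambda>_. 1", OF _ this]
    show "integrable (joint_law M) fst" "integrable (joint_law M) (\<lambda>w. post_mean (fst w + snd w))"
      by (simp_all add: split_beta')
    have "(\<lambda>w. post_mean ((\<lambda>(y, n). y + n) w)) \<in> borel_measurable obs_algebra"
      by measurable
    then show "(\<lambda>w. post_mean (fst w + snd w)) \<in> borel_measurable obs_algebra"
      by (simp add: split_beta')
  qed
qed

lemma integrable_estimator_error: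
  fixes h :: "real \<Rightarrow> real"
  assumes [measurable]: "h \<in> borel_measurable borel"
    and h: "\<And>z. \<bar>h z\<bar> \<le> C * (1 + \<bar>z\<bar>)"
  shows "integrable (joint_law M) (\<lambda>(y, n). (y - h (y + n))\<^sup>2)"
proof -
  have "C \<ge> 0" using order_trans[OF abs_ge_zero h[of 0]] by simp
  have *: "\<bar>y - h (y + n)\<bar> \<le> (1 + C) * (1 + \<bar>y\<bar> + \<bar>n\<bar>)" for y n
    using linear_growth_shift[of h C y n, OF h] abs_triangle_ineq4[of y "h (y + n)"]
    unfolding distrib_right mult_1 by linarith
  show ?thesis
    unfolding power2_eq_square
  proof (rule integrable_joint_law)
    show "\<bar>case (y, n) of (y, n) \<Rightarrow> (y - h (y + n)) * (y - h (y + n))\<bar>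
        \<le> 3 * ((1 + C) * (1 + C)) * (1 + y\<^sup>2 + n\<^sup>2)" for y n
      unfolding prod.case by (rule linear_growth_mult_le[OF * *])
  qed simp
qed

text \<open>Integrating a conditional expectation removes the conditioning, and Tweedie's formula
  identifies the inner one.\<close>

lemma mmse_eq: "mmse M = (\<integral>(y, n). (y - post_mean (y + n))\<^sup>2 \<partial>joint_law M)"
proof -
  interpret S: finite_measure_subalgebra "joint_law M" obs_algebra
    by (rule finite_measure_subalgebra_obs)
  let ?e = "\<lambda>w. (fst w - cond_exp_obs M fst w)\<^sup>2"
  have [measurable]: "cond_exp_obs M fst \<in> borel_measurable (joint_law M)"
    unfolding cond_exp_obs_def by simp
  have ae: "AE w in joint_law M. (\<lambda>(y, n). (y - post_mean (y + n))\<^sup>2) w = ?e w"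
    using tweedie by eventually_elim (simp add: split_beta')
  have int: "integrable (joint_law M) (\<lambda>(y, n). (y - post_mean (y + n))\<^sup>2)"
    by (rule integrable_estimator_error[OF _ abs_post_mean_le]) simp
  have "integrable (joint_law M) ?e"
    by (rule integrable_cong_AE_imp[OF int _ ae]) simp
  then have "mmse M = (\<integral>w. ?e w \<partial>joint_law M)"
    unfolding mmse_def cond_var_obs_def
    by (subst cond_exp_obs_def) (rule S.real_cond_exp_int(2))
  also have "\<dots> = (\<integral>(y, n). (y - post_mean (y + n))\<^sup>2 \<partial>joint_law M)"
    using ae by (intro integral_cong_AE) (auto intro: borel_measurable_integrable[OF int])
  finally show ?thesis .
qed

lemma mmse_le:
  fixes h :: "real \<Rightarrow> real"
  assumes [measurable]: "h \<in> borel_measurable borel"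
    and h: "\<And>z. \<bar>h z\<bar> \<le> C * (1 + \<bar>z\<bar>)"
  shows "mmse M \<le> (\<integral>(y, n). (y - h (y + n))\<^sup>2 \<partial>joint_law M)"
proof -
  let ?D = "1 + growth + C"
  let ?g = "\<lambda>z. post_mean z - h z"
  have g: "\<bar>?g z\<bar> \<le> ?D * (1 + \<bar>z\<bar>)" for z
    using h[of z] abs_post_mean_le[of z] abs_triangle_ineq4[of "post_mean z" "h z"]
    unfolding distrib_right by linarith
  note c = integral_obs_mult_signal[of ?g, OF _ g]
  note e1 = integrable_estimator_error[of post_mean, OF _ abs_post_mean_le]
  note e2 = integrable_estimator_error[of h, OF _ h]
  \<comment> \<open>Pythagoras: by orthogonality the excess error of \<open>h\<close> over the
    posterior mean is exactly the mean square of \<open>?g\<close>.\<close>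
  have "0 \<le> (\<integral>w. (?g (fst w + snd w))\<^sup>2 \<partial>joint_law M)" by simp
  also have "\<dots> = (\<integral>w. (fst w - h (fst w + snd w))\<^sup>2 - (fst w - post_mean (fst w + snd w))\<^sup>2
      - 2 * (?g (fst w + snd w) * fst w - ?g (fst w + snd w) * post_mean (fst w + snd w)) \<partial>joint_law M)"
    by (intro Bochner_Integration.integral_cong) (auto simp: power2_eq_square algebra_simps)
  also have "\<dots> = (\<integral>w. (fst w - h (fst w + snd w))\<^sup>2 \<partial>joint_law M) -
      (\<integral>w. (fst w - post_mean (fst w + snd w))\<^sup>2 \<partial>joint_law M) -
      2 * ((\<integral>w. ?g (fst w + snd w) * fst w \<partial>joint_law M)
       - (\<integral>w. ?g (fst w + snd w) * post_mean (fst w + snd w) \<partial>joint_law M))"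
    using c(1,2) e1 e2
    by (subst Bochner_Integration.integral_diff, simp add: split_beta', simp add: split_beta',
        subst Bochner_Integration.integral_diff, simp add: split_beta', simp add: split_beta',
        subst integral_mult_right_zero,
        subst Bochner_Integration.integral_diff, simp_all add: split_beta')
  also have "\<dots> = (\<integral>w. (fst w - h (fst w + snd w))\<^sup>2 \<partial>joint_law M) - mmse M"
    using c(3) by (simp add: mmse_eq split_beta')
  finally show ?thesis by (simp add: split_beta')
qed

section \<open>The pointwise risk of the posterior mean and its derivative\<close>

definition risk :: "real \<Rightarrow> real" where
  "risk y = (\<integral>n. (n + score (y + n))\<^sup>2 \<partial>std_normal_law)"

definition risk' :: "real \<Rightarrow> real" where
  "risk' y = (\<integral>n. 2 * (n + score (y + n)) * score' (y + n) \<partial>std_normal_law)"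

text \<open>\<open>risk y\<close> is the mean square error at signal \<open>y\<close> of the
  estimator fitted to \<open>M\<close>, whose error is \<open>n + score (y + n)\<close>. The
  estimator stays fixed while the prior \<open>R\<close> varies, so Fubini gives an expression
  linear in \<open>R\<close>.\<close>

lemma integral_risk:
  assumes "second_moment_law R"
  shows "integrable R risk"
    and "(\<integral>y. risk y \<partial>R) = (\<integral>(y, n). (y - post_mean (y + n))\<^sup>2 \<partial>joint_law R)"
proof -
  interpret R: second_moment_law R by fact
  interpret pair_prob_space R std_normal_law by (rule R.pair_prob_space_std_normal)
  have int: "integrable (R \<Otimes>\<^sub>M std_normal_law) (\<lambda>(y, n). (y - post_mean (y + n))\<^sup>2)"
    using R.integrable_estimator_error[OF measurable_post_mean abs_post_mean_le]
    unfolding joint_law_def .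
  have eq: "(y - post_mean (y + n))\<^sup>2 = (n + score (y + n))\<^sup>2" for y n
    unfolding post_mean_def by (simp add: power2_eq_square algebra_simps)
  show "integrable R risk"
    unfolding risk_def[abs_def] eq[symmetric] using integrable_fst'[OF int] by simp
  show "(\<integral>y. risk y \<partial>R) = (\<integral>(y, n). (y - post_mean (y + n))\<^sup>2 \<partial>joint_law R)"
    unfolding risk_def[abs_def] joint_law_def eq[symmetric] using integral_fst'[OF int] by simp
qed

lemma mmse_eq_risk: "mmse M = (\<integral>y. risk y \<partial>M)"
  using integral_risk(2)[OF second_moment_law_axioms] mmse_eq by simp

lemma mmse_le_risk:
  assumes "second_moment_law R"
  shows "mmse R \<le> (\<integral>y. risk y \<partial>R)"
  using second_moment_law.mmse_le[OF assms measurable_post_mean abs_post_mean_le]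
    integral_risk(2)[OF assms] by simp

text \<open>The bounds do not depend on \<open>x\<close>, as domination near \<open>y0\<close>
  requires. The 2 combines the 1 of the growth bounds with the radius 1 of the
  neighbourhood.\<close>

lemma shift_bounds:
  assumes "\<bar>x - y0\<bar> < 1"
  shows "\<bar>score (x + n)\<bar> \<le> growth * (\<bar>y0\<bar> + 2 + \<bar>n\<bar>)"
    and "\<bar>score' (x + n)\<bar> \<le> 3 * growth * (\<bar>y0\<bar> + 2 + \<bar>n\<bar>)\<^sup>2"
    and "\<bar>n + score (x + n)\<bar> \<le> 2 * growth * (\<bar>y0\<bar> + 2 + \<bar>n\<bar>)"
proof -
  let ?r = "\<bar>y0\<bar> + 2 + \<bar>n\<bar>"
  have r: "1 + \<bar>x + n\<bar> \<le> ?r" using assms by linarith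
  have g: "growth \<ge> 1" by (rule growth_ge_1)
  show 1: "\<bar>score (x + n)\<bar> \<le> growth * ?r"
    using abs_score_le[of "x + n"] mult_left_mono[OF r, of growth] g by linarith
  show "\<bar>score' (x + n)\<bar> \<le> 3 * growth * ?r\<^sup>2"
    using abs_score'_le[of "x + n"] mult_left_mono[OF power_mono[OF r, of 2], of "3 * growth"] g
    by linarith
  have "\<bar>n\<bar> \<le> 1 * ?r" by simp
  also have "\<dots> \<le> growth * ?r" using g by (intro mult_right_mono) auto
  finally have 2: "\<bar>n\<bar> \<le> growth * ?r" .
  show "\<bar>n + score (x + n)\<bar> \<le> 2 * growth * ?r"
    using 1 2 abs_triangle_ineq[of n "score (x + n)"] by linarith
qed

lemma shift_integrable:
  shows "integrable std_normal_law (\<lambda>n. score (y + n))"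
    and "integrable std_normal_law (\<lambda>n. n * score (y + n))"
    and "integrable std_normal_law (\<lambda>n. (score (y + n))\<^sup>2)"
    and "integrable std_normal_law (\<lambda>n. score' (y + n))"
    and "integrable std_normal_law (\<lambda>n. (n + score (y + n))\<^sup>2)"
proof -
  let ?r = "\<lambda>n. \<bar>y\<bar> + 2 + \<bar>n\<bar>"
  have y: "\<bar>y - y\<bar> < 1" by simp
  have g: "growth \<ge> 1" by (rule growth_ge_1)
  note b = shift_bounds[OF y]
  have n: "\<bar>n\<bar> \<le> ?r n" for n :: real by simp
  show "integrable std_normal_law (\<lambda>n. score (y + n))"
    by (rule integrable_std_normal_law_bounded[where k=1]) (use b(1) in simp_all)
  show "integrable std_normal_law (\<lambda>n. n * score (y + n))"
  proof (rule integrable_std_normal_law_bounded[where k=2])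
    show "\<bar>n * score (y + n)\<bar> \<le> growth * (?r n)\<^sup>2" for n
      using mult_mono[OF n[of n] b(1)[of n]] by (simp add: abs_mult power2_eq_square mult_ac)
  qed simp
  show "integrable std_normal_law (\<lambda>n. (score (y + n))\<^sup>2)"
  proof (rule integrable_std_normal_law_bounded[where k=2])
    show "\<bar>(score (y + n))\<^sup>2\<bar> \<le> growth\<^sup>2 * (?r n)\<^sup>2" for n
      using power_mono[OF b(1)[of n], of 2] by (simp add: power_mult_distrib)
  qed simp
  show "integrable std_normal_law (\<lambda>n. score' (y + n))"
    by (rule integrable_std_normal_law_bounded[where k=2]) (use b(2) in simp_all)
  show "integrable std_normal_law (\<lambda>n. (n + score (y + n))\<^sup>2)"
  proof (rule integrable_std_normal_law_bounded[where k=2])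
    show "\<bar>(n + score (y + n))\<^sup>2\<bar> \<le> (2 * growth)\<^sup>2 * (?r n)\<^sup>2" for n
      using power_mono[OF b(3)[of n], of 2] by (simp only: power_mult_distrib power2_abs abs_power2 abs_ge_zero)
  qed simp
qed

lemma risk_deriv_bound:
  assumes "\<bar>x - y0\<bar> < 1"
  shows "\<bar>2 * (n + score (x + n)) * score' (x + n)\<bar> \<le> 12 * growth\<^sup>2 * (\<bar>y0\<bar> + 2 + \<bar>n\<bar>) ^ 3"
proof -
  let ?r = "\<bar>y0\<bar> + 2 + \<bar>n\<bar>"
  have "\<bar>n + score (x + n)\<bar> * \<bar>score' (x + n)\<bar> \<le> (2 * growth * ?r) * (3 * growth * ?r\<^sup>2)"
    using shift_bounds[OF assms, of n] growth_ge_1 by (intro mult_mono) auto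
  also have "\<dots> = 6 * growth\<^sup>2 * ?r ^ 3"
    by (simp add: power2_eq_square power3_eq_cube)
  finally show ?thesis by (simp only: abs_mult abs_numeral)
qed

lemma ae_filter_not_bot: "ae_filter M \<noteq> bot"
  by (simp add: trivial_limit_def)

lemma isCont_score_shift: "isCont (\<lambda>x. score (x + n)) x"
  by (rule isCont_o2[where f="\<lambda>x. x + n"]) (auto simp: isCont_score)

lemma isCont_score'_shift: "isCont (\<lambda>x. score' (x + n)) x"
  by (rule isCont_o2[where f="\<lambda>x. x + n"]) (auto simp: isCont_score')

lemma DERIV_risk: "(risk has_real_derivative risk' y) (at y)"
proof -
  have "((\<lambda>x. \<integral>n. (n + score (x + n))\<^sup>2 \<partial>std_normal_law) has_real_derivative
      (\<integral>n. 2 * (n + score (y + n)) * score' (y + n) \<partial>std_normal_law)) (at y)"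
  proof (rule has_real_derivative_integral[where
        f'="\<lambda>x n. 2 * (n + score (x + n)) * score' (x + n)" and
        w="\<lambda>n. 12 * growth\<^sup>2 * (\<bar>y\<bar> + 2 + \<bar>n\<bar>) ^ 3"])
    show "((\<lambda>x. (n + score (x + n))\<^sup>2) has_real_derivative 2 * (n + score (x + n)) * score' (x + n)) (at x)"
      for x n
    proof -
      have "((\<lambda>x. score (x + n)) has_real_derivative score' (x + n)) (at x)"
        using DERIV_score[of "x + n"] by (simp add: DERIV_shift)
      from DERIV_power[OF DERIV_add[OF DERIV_const this], of n 2]
      show ?thesis by (simp add: algebra_simps)
    qed
    show "integrable std_normal_law (\<lambda>n. 12 * growth\<^sup>2 * (\<bar>y\<bar> + 2 + \<bar>n\<bar>) ^ 3)"
      by (intro integrable_mult_right integrable_std_normal_law_abs_power)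
  qed (use risk_deriv_bound shift_integrable(5) in simp_all)
  then show ?thesis
    unfolding risk_def[abs_def] risk'_def .
qed

lemma isCont_risk': "isCont risk' y"
  unfolding isCont_def risk'_def[abs_def]
proof (rule tendsto_integral_dominated_at[where
      w="\<lambda>n. 12 * growth\<^sup>2 * (\<bar>y\<bar> + 2 + \<bar>n\<bar>) ^ 3"])
  show "integrable std_normal_law (\<lambda>n. 12 * growth\<^sup>2 * (\<bar>y\<bar> + 2 + \<bar>n\<bar>) ^ 3)"
    by (intro integrable_mult_right integrable_std_normal_law_abs_power)
  show "(\<lambda>x. 2 * (n + score (x + n)) * score' (x + n)) \<midarrow>y\<rightarrow> 2 * (n + score (y + n)) * score' (y + n)" for n
  proof -
    have "isCont (\<lambda>x. 2 * (n + score (x + n)) * score' (x + n)) y"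
      by (intro isCont_mult isCont_add isCont_score_shift isCont_score'_shift) auto
    then show ?thesis by (simp add: isCont_def)
  qed
qed (use risk_deriv_bound in simp_all)

section \<open>Stein's identity and the convolution form of the risk\<close>

lemma score_shift_mult_density_tendsto_0:
  "((\<lambda>n. score (y + n) * std_normal_density n) \<longlongrightarrow> 0) at_infinity"
proof (rule Lim_null_comparison)
  let ?c = "\<bar>y\<bar> + 2"
  show "((\<lambda>n. growth * 2 * (?c * (inverse n * inverse n) + \<bar>inverse n\<bar>)) \<longlongrightarrow> 0) at_infinity"
    by (rule tendsto_eq_intros tendsto_inverse_0 refl | simp)+
  show "\<forall>\<^sub>F n in at_infinity. norm (score (y + n) * std_normal_density n) \<le>
      growth * 2 * (?c * (inverse n * inverse n) + \<bar>inverse n\<bar>)"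
    unfolding eventually_at_infinity
  proof (intro exI[of _ 1] allI impI)
    fix n :: real assume "1 \<le> norm n"
    then have n: "n \<noteq> 0" by auto
    \<comment> \<open>Quadratic decay already beats the linear growth of the score.\<close>
    have "std_normal_density n \<le> 2 / n\<^sup>2"
      using square_mult_std_normal_density_le[of n] n by (simp add: field_simps)
    then have "\<bar>score (y + n)\<bar> * std_normal_density n \<le> (growth * (?c + \<bar>n\<bar>)) * (2 / n\<^sup>2)"
      using shift_bounds(1)[of y y n] growth_ge_1 by (intro mult_mono) auto
    also have "\<dots> = growth * 2 * (?c * (inverse n * inverse n) + \<bar>n\<bar> / \<bar>n\<bar>\<^sup>2)"
      by (simp add: field_simps power2_eq_square add_divide_distrib)
    also have "\<bar>n\<bar> / \<bar>n\<bar>\<^sup>2 = \<bar>inverse n\<bar>"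
      using n by (simp add: power2_eq_square divide_simps)
    finally show "norm (score (y + n) * std_normal_density n) \<le>
        growth * 2 * (?c * (inverse n * inverse n) + \<bar>inverse n\<bar>)"
      by (simp add: abs_mult)
  qed
qed

text \<open>Integration by parts: the derivative of the normal density is \<open>- n\<close> times
  the density, and the boundary terms vanish.\<close>

lemma stein_score:
  "(\<integral>n. n * score (y + n) \<partial>std_normal_law) = (\<integral>n. score' (y + n) \<partial>std_normal_law)"
proof -
  let ?F = "\<lambda>n. score (y + n) * std_normal_density n"
  let ?f = "\<lambda>n. score' (y + n) * std_normal_density n - (n * score (y + n)) * std_normal_density n"
  have i: "integrable lborel (\<lambda>n. score' (y + n) * std_normal_density n)"
    "integrable lborel (\<lambda>n. (n * score (y + n)) * std_normal_density n)"
    using shift_integrable(2,4)[of y] by (simp_all add: integrable_std_normal_law_iff)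
  have "(LBINT n=-\<infinity>..\<infinity>. ?f n) = 0 - 0"
  proof (rule interval_integral_FTC_integrable[where F="?F"])
    fix x
    have "((\<lambda>n. score (y + n)) has_real_derivative score' (y + x)) (at x)"
      using DERIV_score[of "x + y"] by (simp add: DERIV_shift add.commute)
    from DERIV_mult[OF this DERIV_std_normal_density]
    show "(?F has_vector_derivative ?f x) (at x)"
      unfolding has_real_derivative_iff_has_vector_derivative[symmetric]
      by (rule DERIV_cong) (simp add: algebra_simps)
    show "isCont ?f x"
      using isCont_score_shift[where n=y] isCont_score'_shift[where n=y]
      by (intro isCont_diff isCont_mult DERIV_isCont[OF DERIV_std_normal_density])
        (simp_all add: add.commute[of y])
  next
    show "set_integrable lborel (einterval (- \<infinity>) \<infinity>) ?f"
      using i by (simp add: set_integrable_def)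
    show "((?F \<circ> real_of_ereal) \<longlongrightarrow> 0) (at_right (- \<infinity>))"
      unfolding ereal_tendsto_simps1
      by (rule filterlim_mono[OF score_shift_mult_density_tendsto_0 order_refl at_bot_le_at_infinity])
    show "((?F \<circ> real_of_ereal) \<longlongrightarrow> 0) (at_left \<infinity>)"
      unfolding ereal_tendsto_simps1
      by (rule filterlim_mono[OF score_shift_mult_density_tendsto_0 order_refl at_top_le_at_infinity])
  qed simp
  then have "(\<integral>n. ?f n \<partial>lborel) = 0"
    by (simp add: interval_lebesgue_integral_def set_lebesgue_integral_def)
  then show ?thesis
    using i by (simp add: integral_std_normal_law)
qed

lemma deriv_ln_conv_measure: "deriv (\<lambda>z. ln (conv_measure M z)) = score"
proof
  fix z
  have "conv_measure M = p0"
    by (auto simp: conv_measure_def p0_def)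
  moreover have "((\<lambda>z. ln (p0 z)) has_real_derivative score z) (at z)"
    unfolding score_def using DERIV_p0[of z] p0_pos[of z]
    by (auto intro!: derivative_eq_intros)
  ultimately show "deriv (\<lambda>z. ln (conv_measure M z)) z = score z"
    by (simp add: DERIV_imp_deriv)
qed

lemma deriv_score: "deriv score = score'"
  using DERIV_imp_deriv[OF DERIV_score] by auto

text \<open>Expanding the square in \<open>risk\<close>, the noise contributes its variance 1 and
  Stein's identity turns the cross term into the integral of \<open>2 * score'\<close>.\<close>

lemma conv_fun_eq_risk: "conv_fun (\<lambda>z. 2 * score' z + (score z)\<^sup>2) y = risk y - 1"
proof -
  have N: "integrable std_normal_law (\<lambda>n. n\<^sup>2)"
    using integrable_std_normal_law_abs_power[of 0 2] by simp
  have "conv_fun (\<lambda>z. 2 * score' z + (score z)\<^sup>2) y =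
      (\<integral>n. 2 * score' (y + n) + (score (y + n))\<^sup>2 \<partial>std_normal_law)"
    unfolding conv_fun_def
    by (subst std_normal_density_minus) (rule integral_translate, simp)
  also have "\<dots> = 2 * (\<integral>n. n * score (y + n) \<partial>std_normal_law) + (\<integral>n. (score (y + n))\<^sup>2 \<partial>std_normal_law)"
    using shift_integrable(3,4)[of y] by (simp add: stein_score)
  also have "\<dots> = risk y - 1"
  proof -
    have "risk y = (\<integral>n. n\<^sup>2 + (2 * (n * score (y + n)) + (score (y + n))\<^sup>2) \<partial>std_normal_law)"
      unfolding risk_def by (simp add: power2_sum algebra_simps)
    also have "\<dots> = 1 + (2 * (\<integral>n. n * score (y + n) \<partial>std_normal_law) +
        (\<integral>n. (score (y + n))\<^sup>2 \<partial>std_normal_law))"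
      using N shift_integrable(2,3)[of y]
      by (subst Bochner_Integration.integral_add) (simp_all add: std_normal_law_second_moment)
    finally show ?thesis by simp
  qed
  finally show ?thesis .
qed

section \<open>Independence of the chosen version of the posterior mean\<close>

lemma posterior_mean_AE_eq:
  assumes "posterior_mean M m"
  shows "AE z in lborel. m z = post_mean z"
proof -
  interpret pair_prob_space M std_normal_law by (rule pair_prob_space_std_normal)
  have [measurable]: "m \<in> borel_measurable borel"
    and m: "AE w in joint_law M. cond_exp_obs M fst w = m (fst w + snd w)"
    using assms by (simp_all add: posterior_mean_def split_beta')
  have "AE w in M \<Otimes>\<^sub>M std_normal_law. m (fst w + snd w) = post_mean (fst w + snd w)"
    unfolding joint_law_def[symmetric] using m tweedie by eventually_elim simp
  from AE_pair[OF this]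
  have "AE y in M. AE n in std_normal_law. m (y + n) = post_mean (y + n)" by simp
  \<comment> \<open>A single \<open>y\<close> suffices: the normal density is positive and Lebesgue
    measure is translation invariant.\<close>
  then obtain y where "AE n in std_normal_law. m (y + n) = post_mean (y + n)"
    using eventually_happens'[OF ae_filter_not_bot] by blast
  then have "AE n in lborel. m (y + n) = post_mean (y + n)"
    by (simp add: AE_density std_normal_density_pos)
  then have "AE z in distr lborel borel ((+) y). m z = post_mean z"
    by (subst AE_distr_iff) simp_all
  then show ?thesis
    unfolding lborel_distr_plus .
qed

text \<open>Both integrals are against Lebesgue measure and ignore the null set where
  \<open>m\<close> differs from \<open>post_mean\<close>, so the identity holds at every
  \<open>y\<close>.\<close>

lemma quadratic_eq_risk:
  assumes "posterior_mean M m"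
  shows "y\<^sup>2 - 2 * y * (\<integral>z. m z * std_normal_density (z - y) \<partial>lborel) +
    (\<integral>z. (m z)\<^sup>2 * std_normal_density (z - y) \<partial>lborel) = risk y"
proof -
  interpret N: prob_space std_normal_law by (rule prob_space_std_normal_law)
  have [measurable]: "m \<in> borel_measurable borel"
    using assms by (simp add: posterior_mean_def)
  note ae = posterior_mean_AE_eq[OF assms]
  have a: "(\<integral>z. m z * std_normal_density (z - y) \<partial>lborel) = (\<integral>n. post_mean (y + n) \<partial>std_normal_law)"
  proof -
    have "(\<integral>z. m z * std_normal_density (z - y) \<partial>lborel) =
        (\<integral>z. post_mean z * std_normal_density (z - y) \<partial>lborel)"
      by (rule integral_cong_AE) (use ae in auto)
    then show ?thesis by (simp add: integral_translate)
  qed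
  have b: "(\<integral>z. (m z)\<^sup>2 * std_normal_density (z - y) \<partial>lborel) = (\<integral>n. (post_mean (y + n))\<^sup>2 \<partial>std_normal_law)"
  proof -
    have "(\<integral>z. (m z)\<^sup>2 * std_normal_density (z - y) \<partial>lborel) =
        (\<integral>z. (post_mean z)\<^sup>2 * std_normal_density (z - y) \<partial>lborel)"
      by (rule integral_cong_AE) (use ae in auto)
    then show ?thesis by (simp add: integral_translate)
  qed
  have "\<bar>post_mean (y + n)\<bar> \<le> (1 + growth) * (1 + \<bar>y\<bar> + \<bar>n\<bar>)" for n
    by (rule linear_growth_shift[OF abs_post_mean_le])
  note bound = this
  have i1: "integrable std_normal_law (\<lambda>n. post_mean (y + n))"
    by (rule integrable_std_normal_law_bounded[where k=1 and r="1 + \<bar>y\<bar>"]) (use bound in simp_all)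
  have i2: "integrable std_normal_law (\<lambda>n. (post_mean (y + n))\<^sup>2)"
  proof (rule integrable_std_normal_law_bounded[where k=2 and r="1 + \<bar>y\<bar>"])
    show "\<bar>(post_mean (y + n))\<^sup>2\<bar> \<le> (1 + growth)\<^sup>2 * (1 + \<bar>y\<bar> + \<bar>n\<bar>)\<^sup>2" for n
      using power_mono[OF bound[of n], of 2]
      by (simp only: power_mult_distrib power2_abs abs_power2 abs_ge_zero)
  qed simp
  have "risk y = (\<integral>n. y\<^sup>2 - 2 * y * post_mean (y + n) + (post_mean (y + n))\<^sup>2 \<partial>std_normal_law)"
    unfolding risk_def post_mean_def
    by (intro Bochner_Integration.integral_cong) (auto simp: power2_eq_square algebra_simps)
  also have "\<dots> = y\<^sup>2 - 2 * y * (\<integral>n. post_mean (y + n) \<partial>std_normal_law) +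
      (\<integral>n. (post_mean (y + n))\<^sup>2 \<partial>std_normal_law)"
    using i1 i2 N.prob_space by simp
  finally show ?thesis unfolding a b by simp
qed

end

subsection \<open>Monotone transport on the line\<close>

lemma (in real_distribution) cdf_attains:
  assumes cont: "\<And>x. isCont (cdf M) x" and u: "0 < u" "u < 1"
  obtains x where "cdf M x = u"
proof -
  obtain a where a: "cdf M a < u"
    using eventually_happens'[OF _ order_tendstoD(2)[OF cdf_lim_at_bot u(1)]]
    by (auto simp: trivial_limit_at_bot_linorder)
  obtain b where b: "u < cdf M b"
    using eventually_happens'[OF _ order_tendstoD(1)[OF cdf_lim_at_top_prob u(2)]]
    by (auto simp: trivial_limit_at_top_linorder)
  have "a \<le> b"
    using a b cdf_nondecreasing[of b a] by linarith
  then show thesis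
    using IVT[of "cdf M" a u b] a b cont that by auto
qed

lemma abs_mult_le_sum_squares: "\<bar>x * y\<bar> \<le> x\<^sup>2 + (y::real)\<^sup>2"
proof -
  have "0 \<le> (\<bar>x\<bar> - \<bar>y\<bar>)\<^sup>2" "0 \<le> \<bar>x * y\<bar>" by simp_all
  then show ?thesis unfolding power2_diff abs_mult power2_abs by linarith
qed

section \<open>Couplings and c-concave functions\<close>

lemma W2_sq_le_coupling:
  assumes [measurable]: "f \<in> borel_measurable Q" "g \<in> borel_measurable Q"
    and P: "distr Q borel f = P" and R: "distr Q borel g = R"
    and int: "integrable Q (\<lambda>y. (f y - g y)\<^sup>2)"
  shows "W2_sq P R \<le> (\<integral>y. (f y - g y)\<^sup>2 \<partial>Q)"
proof -
  let ?\<pi> = "distr Q (borel \<Otimes>\<^sub>M borel) (\<lambda>y. (f y, g y))"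
  have "?\<pi> \<in> couplings P R"
    unfolding couplings_def P[symmetric] R[symmetric]
    by (auto simp: distr_distr comp_def)
  then have "(INF \<pi>\<in>couplings P R. \<integral>\<^sup>+ (x, y). ennreal ((x - y)\<^sup>2) \<partial>\<pi>) \<le>
      (\<integral>\<^sup>+ (x, y). ennreal ((x - y)\<^sup>2) \<partial>?\<pi>)"
    by (rule INF_lower)
  also have "\<dots> = (\<integral>\<^sup>+y. ennreal ((f y - g y)\<^sup>2) \<partial>Q)"
    by (subst nn_integral_distr) (auto simp: split_beta')
  also have "\<dots> = ennreal (\<integral>y. (f y - g y)\<^sup>2 \<partial>Q)"
    using int by (rule nn_integral_eq_integral) simp
  finally have "enn2real (INF \<pi>\<in>couplings P R. \<integral>\<^sup>+ (x, y). ennreal ((x - y)\<^sup>2) \<partial>\<pi>) \<le>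
      enn2real (ennreal (\<integral>y. (f y - g y)\<^sup>2 \<partial>Q))"
    by (intro enn2real_mono) auto
  then show ?thesis unfolding W2_sq_def by simp
qed

text \<open>Half the square minus \<phi> is a supremum of affine functions, hence convex. As a lower
  bound in the extended reals, the inequality also rules out the value \<open>- \<infinity>\<close>
  between two points of finiteness.\<close>

lemma c_concave_interpolation:
  assumes conc: "c_concave \<phi>" and r: "\<phi> x = ereal r" "\<phi> y = ereal q"
    and uv: "0 \<le> u" "0 \<le> v" "u + v = 1" and z: "z = u * x + v * y"
  shows "ereal (z\<^sup>2 / 2 - (u * (x\<^sup>2 / 2 - r) + v * (y\<^sup>2 / 2 - q))) \<le> \<phi> z"
proof -
  obtain g where g: "\<phi> = c_transform g"
    using conc by (auto simp: c_concave_def)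
  show ?thesis
    unfolding g c_transform_def[of g z]
  proof (rule INF_greatest)
    fix t
    have le: "\<phi> w \<le> ereal ((w - t)\<^sup>2 / 2) - g t" for w
      unfolding g c_transform_def by (rule INF_lower) simp
    show "ereal (z\<^sup>2 / 2 - (u * (x\<^sup>2 / 2 - r) + v * (y\<^sup>2 / 2 - q))) \<le> ereal ((z - t)\<^sup>2 / 2) - g t"
    proof (cases "g t")
      case (real c)
      have "r \<le> (x - t)\<^sup>2 / 2 - c" "q \<le> (y - t)\<^sup>2 / 2 - c"
        using le[of x] le[of y] by (simp_all add: r real)
      then have "u * r + v * q \<le> u * ((x - t)\<^sup>2 / 2 - c) + v * ((y - t)\<^sup>2 / 2 - c)"
        using uv by (intro add_mono mult_left_mono)
      also have "\<dots> = u * (x\<^sup>2 / 2) + v * (y\<^sup>2 / 2) - t * (u * x + v * y) + (u + v) * (t\<^sup>2 / 2 - c)"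
        by (simp add: power2_diff field_simps)
      also have "\<dots> = u * (x\<^sup>2 / 2) + v * (y\<^sup>2 / 2) - t * z + t\<^sup>2 / 2 - c"
        by (simp add: uv z)
      finally show ?thesis by (simp add: real power2_diff field_simps)
    next
      \<comment> \<open>This value of \<open>g t\<close> would force \<phi> to be
        \<open>- \<infinity>\<close> at \<open>x\<close>, where it equals \<open>r\<close>.\<close>
      case PInf
      then show ?thesis using le[of x] by (simp add: r)
    qed simp
  qed
qed

text \<open>
  By c-concavity \<open>y\<^sup>2 / 2 - \<phi> y\<close> is convex; it has the subgradient \<open>T y\<close> at the points of a dense
  set, hence everywhere by continuity of \<open>T\<close>.
\<close>
lemma c_concave_DERIV:
  fixes T :: "real \<Rightarrow> real"
  assumes conc: "c_concave \<phi>"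
    and dense: "closure A = UNIV"
    and A: "\<And>y. y \<in> A \<Longrightarrow> \<bar>\<phi> y\<bar> \<noteq> \<infinity>"
      "\<And>y z. y \<in> A \<Longrightarrow> \<phi> z \<le> ereal (real_of_ereal (\<phi> y) + (T y - z)\<^sup>2 / 2 - (T y - y)\<^sup>2 / 2)"
    and T: "continuous_on UNIV T"
  obtains f where "\<And>y. \<phi> y = ereal (f y)" "\<And>y. (f has_real_derivative y - T y) (at y)"
proof -
  define f where "f y = real_of_ereal (\<phi> y)" for y
  have meets: "\<exists>y\<in>A. a < y \<and> y < b" if "a < b" for a b
  proof -
    have "{a<..<b} \<inter> closure A \<noteq> {}" using that by (simp add: dense)
    then have "{a<..<b} \<inter> A \<noteq> {}" by (subst (asm) open_Int_closure_eq_empty) auto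
    then show ?thesis by auto
  qed
  have fA: "\<phi> y = ereal (f y)" if "y \<in> A" for y
    using A(1)[OF that] by (simp add: f_def ereal_real')
  have f: "\<phi> y = ereal (f y)" for y
  proof -
    \<comment> \<open>Density of \<open>A\<close> places \<open>y\<close> between two points of
      finiteness, so interpolation makes \<phi> finite at \<open>y\<close> too.\<close>
    obtain a where a: "a \<in> A" "y - 1 < a" "a < y" using meets[of "y - 1" y] by auto
    obtain b where b: "b \<in> A" "y < b" "b < y + 1" using meets[of y "y + 1"] by auto
    let ?u = "(b - y) / (b - a)" and ?v = "(y - a) / (b - a)"
    have uv: "?u + ?v = 1" using a b by (simp add: add_divide_distrib[symmetric])
    have "?u * a + ?v * b = ((b - y) * a + (y - a) * b) / (b - a)"
      by (simp add: add_divide_distrib)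
    also have "(b - y) * a + (y - a) * b = y * (b - a)" by (simp add: algebra_simps)
    finally have y: "y = ?u * a + ?v * b" using a b by simp
    have "\<phi> y \<noteq> - \<infinity>"
      using c_concave_interpolation[OF conc fA[OF a(1)] fA[OF b(1)] _ _ uv y] a b by auto
    moreover have "\<phi> y \<noteq> \<infinity>" using conc by (simp add: c_concave_def)
    ultimately show ?thesis by (cases "\<phi> y") (auto simp: f_def)
  qed
  define F where "F y = y\<^sup>2 / 2 - f y" for y
  have "convex_on UNIV F"
  proof (rule convex_onI)
    fix t x y :: real assume t: "0 < t" "t < 1"
    have "ereal (((1 - t) * x + t * y)\<^sup>2 / 2 - ((1 - t) * F x + t * F y)) \<le> ereal (f ((1 - t) * x + t * y))"
      unfolding F_def f[symmetric]
      by (rule c_concave_interpolation[OF conc f f]) (use t in auto)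
    then show "F ((1 - t) *\<^sub>R x + t *\<^sub>R y) \<le> (1 - t) * F x + t * F y"
      by (simp add: F_def)
  qed simp
  then have contF: "continuous_on UNIV F"
    by (rule convex_on_continuous[rotated]) simp
  have sub: "F y + T y * (z - y) \<le> F z" for y z
  proof -
    have "closed {y. F y + T y * (z - y) \<le> F z}"
      by (intro closed_Collect_le continuous_intros contF T)
    moreover have "A \<subseteq> {y. F y + T y * (z - y) \<le> F z}"
      using A(2)[of _ z] unfolding f real_of_ereal.simps
      by (auto simp: F_def power2_diff field_simps)
    ultimately have "closure A \<subseteq> {y. F y + T y * (z - y) \<le> F z}"
      by (rule closure_minimal[rotated])
    then show ?thesis by (auto simp: dense)
  qed
  have DF: "(F has_real_derivative T y) (at y)" for y
  proof -
    \<comment> \<open>The subgradient inequalities at \<open>y\<close> and at \<open>z\<close> trap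
      the difference quotient between \<open>T y\<close> and \<open>T z\<close>.\<close>
    have "((\<lambda>z. (F z - F y) / (z - y) - T y) \<longlongrightarrow> 0) (at y)"
    proof (rule Lim_null_comparison)
      have "isCont T y" using T by (simp add: continuous_on_eq_continuous_at)
      then have "((\<lambda>z. T z - T y) \<longlongrightarrow> T y - T y) (at y)"
        unfolding isCont_def by (intro tendsto_intros)
      then show "((\<lambda>z. \<bar>T z - T y\<bar>) \<longlongrightarrow> 0) (at y)"
        by (simp add: tendsto_rabs_zero)
      show "\<forall>\<^sub>F z in at y. norm ((F z - F y) / (z - y) - T y) \<le> \<bar>T z - T y\<bar>"
        unfolding eventually_at_filter
      proof (intro always_eventually allI impI)
        fix z assume "z \<noteq> y"
        have *: "T y * (z - y) \<le> F z - F y" "F z - F y \<le> T z * (z - y)"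
          using sub[of y z] sub[of z y] by (simp_all add: algebra_simps)
        show "norm ((F z - F y) / (z - y) - T y) \<le> \<bar>T z - T y\<bar>"
        proof (cases "y < z")
          case True
          then have "T y \<le> (F z - F y) / (z - y)" "(F z - F y) / (z - y) \<le> T z"
            using * by (simp_all add: pos_le_divide_eq pos_divide_le_eq)
          then show ?thesis by simp
        next
          case False
          then have "z - y < 0" using \<open>z \<noteq> y\<close> by simp
          then have "(F z - F y) / (z - y) \<le> T y" "T z \<le> (F z - F y) / (z - y)"
            using * by (simp_all add: neg_le_divide_eq neg_divide_le_eq)
          then show ?thesis by simp
        qed
      qed
    qed
    then show ?thesis
      unfolding has_field_derivative_iff by (simp add: Lim_null[symmetric])
  qed
  have "f = (\<lambda>y. y\<^sup>2 / 2 - F y)" by (auto simp: F_def)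
  then have "(f has_real_derivative y - T y) (at y)" for y
    using DF[of y] by (auto intro!: derivative_eq_intros)
  with f show thesis by (rule that)
qed

text \<open>\<open>I\<close> stands for the interior of the support of \<open>Q\<close>. The
  assumptions make the transport map an increasing bijection from \<open>I\<close> onto the whole
  line.\<close>

locale monotone_transport = P: second_moment_law P + Q: second_moment_law Q
  for P Q :: "real measure" +
  fixes I :: "real set"
  assumes isCont_cdf_P: "isCont (cdf P) x"
    and strict_mono_cdf_P: "strict_mono (cdf P)"
    and isCont_cdf_Q: "isCont (cdf Q) x"
    and open_I: "open I"
    and interval_I: "is_interval I"
    and AE_I: "AE y in Q. y \<in> I"
    and cdf_Q_less: "a \<in> I \<Longrightarrow> b \<in> I \<Longrightarrow> a < b \<Longrightarrow> cdf Q a < cdf Q b"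
begin

section \<open>The monotone transport map\<close>

definition T :: "real \<Rightarrow> real" where
  "T y = quantile P (cdf Q y)"

lemma sets_I[measurable]: "I \<in> sets borel"
  using open_I by simp

lemma open_I_around:
  assumes "y \<in> I"
  obtains a b where "a < y" "y < b" "{a..b} \<subseteq> I"
proof -
  obtain e where e: "e > 0" "cball y e \<subseteq> I"
    using open_contains_cball_eq[OF open_I] assms by blast
  then show thesis
    by (intro that[of "y - e" "y + e"]) (auto simp: cball_eq_atLeastAtMost)
qed

lemma cdf_Q_bounds:
  assumes "y \<in> I"
  shows "0 < cdf Q y" "cdf Q y < 1"
proof -
  obtain a b where ab: "a < y" "y < b" "{a..b} \<subseteq> I"
    using open_I_around[OF assms] .
  then have "a \<in> I" "b \<in> I" by auto
  then show "0 < cdf Q y" "cdf Q y < 1"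
    using cdf_Q_less[of a y] cdf_Q_less[of y b] ab assms Q.cdf_nonneg[of a] Q.cdf_bounded_prob[of b]
    by auto
qed

lemma cdf_P_bounds: "0 < cdf P x" "cdf P x < 1"
  using strict_monoD[OF strict_mono_cdf_P, of "x - 1" x] P.cdf_nonneg[of "x - 1"]
    strict_monoD[OF strict_mono_cdf_P, of x "x + 1"] P.cdf_bounded_prob[of "x + 1"]
  by auto

lemma quantile_cdf: "quantile P (cdf P x) = x"
proof -
  have "{z. cdf P x \<le> cdf P z} = {x..}"
    using strict_mono_less_eq[OF strict_mono_cdf_P] by auto
  then show ?thesis unfolding quantile_def by simp
qed

lemma cdf_T:
  assumes "y \<in> I"
  shows "cdf P (T y) = cdf Q y"
proof -
  obtain x where "cdf P x = cdf Q y"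
    using P.cdf_attains[OF isCont_cdf_P cdf_Q_bounds[OF assms]] .
  then show ?thesis
    unfolding T_def by (metis quantile_cdf)
qed

lemma T_less: "a \<in> I \<Longrightarrow> b \<in> I \<Longrightarrow> a < b \<Longrightarrow> T a < T b"
  using cdf_Q_less[of a b] cdf_T strict_mono_less[OF strict_mono_cdf_P] by metis

lemma T_mono: "a \<in> I \<Longrightarrow> b \<in> I \<Longrightarrow> a \<le> b \<Longrightarrow> T a \<le> T b"
  using T_less[of a b] by (cases "a = b") auto

text \<open>An interval that misses \<open>y\<close> lies on one side of it, which forces the cdf of
  \<open>Q\<close> at \<open>y\<close> to be 0 or 1.\<close>

lemma mem_I:
  assumes "0 < cdf Q y" "cdf Q y < 1"
  shows "y \<in> I"
proof (rule ccontr)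
  assume y: "y \<notin> I"
  have "I \<subseteq> {..y} \<or> I \<subseteq> {y<..}"
  proof (rule ccontr)
    assume "\<not> ?thesis"
    then obtain u v where "u \<in> I" "v \<in> I" "y < u" "v \<le> y" by (auto simp: subset_eq not_le not_less)
    then show False using y mem_is_interval_1_I[OF interval_I, of v u y] by simp
  qed
  then show False
  proof
    assume "I \<subseteq> {..y}"
    then have "AE x in Q. x \<in> {..y}"
      using AE_I by (auto elim: eventually_mono)
    then have "cdf Q y = 1"
      unfolding cdf_def by (rule Q.prob_eq_1[THEN iffD2, rotated]) simp
    then show False using assms by simp
  next
    assume "I \<subseteq> {y<..}"
    then have "AE x in Q. x \<notin> {..y}"
      using AE_I by (auto elim!: eventually_mono)
    then have "cdf Q y = 0"
      unfolding cdf_def by (subst Q.prob_eq_0) auto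
    then show False using assms by simp
  qed
qed

lemma T_surj:
  obtains y where "y \<in> I" "T y = x"
proof -
  obtain y where y: "cdf Q y = cdf P x"
    using Q.cdf_attains[OF isCont_cdf_Q cdf_P_bounds] .
  then have "y \<in> I" using cdf_P_bounds[of x] by (intro mem_I) auto
  moreover have "T y = x" unfolding T_def y by (rule quantile_cdf)
  ultimately show thesis by (rule that)
qed

lemma T_image: "T ` I = UNIV"
  by (metis T_surj image_eqI surj_def UNIV_eq_I)

text \<open>A monotone function whose image is the whole line has no jumps.\<close>

lemma continuous_on_T: "continuous_on I T"
  by (rule continuous_onI_mono) (auto simp: T_image intro: T_mono)

text \<open>\<open>T\<close> has junk values outside \<open>I\<close>, where \<open>cdf Q\<close> is 0 or 1; these form a \<open>Q\<close>-null set.\<close>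
definition T0 :: "real \<Rightarrow> real" where
  "T0 y = (if y \<in> I then T y else 0)"

lemma measurable_T0[measurable]: "T0 \<in> borel_measurable borel"
  unfolding T0_def[abs_def]
  by (rule borel_measurable_continuous_on_if) (auto simp: continuous_on_T)

lemma AE_T0: "AE y in Q. T0 y = T y"
  using AE_I by eventually_elim (simp add: T0_def)

text \<open>Up to a \<open>Q\<close>-null set, monotonicity turns the event
  \<open>T0 z \<le> T y\<close> into \<open>z \<le> y\<close>, so the two cdfs agree.\<close>

lemma distr_T0: "distr Q borel T0 = P"
proof (rule cdf_unique)
  show "real_distribution (distr Q borel T0)"
    by (rule Q.real_distribution_distr) simp
  show "real_distribution P" by unfold_locales
  show "cdf (distr Q borel T0) = cdf P"
  proof
    fix x
    obtain y where y: "y \<in> I" "T y = x" by (rule T_surj)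
    have "cdf (distr Q borel T0) x = measure Q {z. T0 z \<le> x}"
      unfolding cdf_def by (subst measure_distr) (auto simp: vimage_def)
    also have "\<dots> = measure Q {..y}"
    proof (rule Q.finite_measure_eq_AE)
      show "AE z in Q. z \<in> {z. T0 z \<le> x} \<longleftrightarrow> z \<in> {..y}"
        using AE_I
      proof eventually_elim
        case (elim z)
        have "T z \<le> T y \<longleftrightarrow> z \<le> y"
          using elim y T_mono[of z y] T_less[of y z] by (cases "z \<le> y") auto
        with elim y show ?case by (simp add: T0_def)
      qed
    qed auto
    also have "\<dots> = cdf P x"
      using cdf_T[OF y(1)] y by (simp add: cdf_def)
    finally show "cdf (distr Q borel T0) x = cdf P x" .
  qed
qed

lemma integrable_P_iff:
  fixes f :: "real \<Rightarrow> real"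
  assumes "f \<in> borel_measurable borel"
  shows "integrable P f \<longleftrightarrow> integrable Q (\<lambda>y. f (T0 y))"
  using integrable_distr_eq[of T0 Q borel f] assms by (simp add: distr_T0)

lemma integral_P:
  fixes f :: "real \<Rightarrow> real"
  assumes "f \<in> borel_measurable borel"
  shows "(\<integral>x. f x \<partial>P) = (\<integral>y. f (T0 y) \<partial>Q)"
  using integral_distr[of T0 Q borel f] assms by (simp add: distr_T0)

lemma T0_sq_integrable: "integrable Q (\<lambda>y. (T0 y)\<^sup>2)"
  using P.sq_integrable by (simp add: integrable_P_iff)

lemma T0_integrable: "integrable Q T0"
  by (rule Q.square_integrable_imp_integrable[OF _ T0_sq_integrable]) simp

lemma T0_mult_integrable: "integrable Q (\<lambda>y. y * T0 y)"
proof (rule Bochner_Integration.integrable_bound)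
  show "integrable Q (\<lambda>y. y\<^sup>2 + (T0 y)\<^sup>2)"
    using Q.sq_integrable T0_sq_integrable by simp
  show "AE y in Q. norm (y * T0 y) \<le> norm (y\<^sup>2 + (T0 y)\<^sup>2)"
    by (intro AE_I2) (simp add: abs_mult_le_sum_squares)
qed simp

section \<open>Dual potentials for the quadratic cost\<close>

definition base :: real where
  "base = (SOME y. y \<in> I)"

lemma base: "base \<in> I"
  unfolding base_def using T_surj[of 0] by (metis someI)

text \<open>The Brenier potential: an antiderivative of the increasing map \<open>T\<close>, hence
  convex on \<open>I\<close>.\<close>

definition U :: "real \<Rightarrow> real" where
  "U y = (LBINT u=base..y. T u)"

lemma DERIV_U:
  assumes "y \<in> I"
  shows "(U has_real_derivative T y) (at y)"
proof -
  obtain a b where ab: "a < y" "y < b" "{a..b} \<subseteq> I"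
    using open_I_around[OF assms] .
  \<comment> \<open>The segment must contain the anchor \<open>base\<close> of the integral and have
    \<open>y\<close> in its interior.\<close>
  let ?a = "min a base" and ?b = "max b base"
  have sub: "{?a..?b} \<subseteq> I"
  proof
    fix z assume z: "z \<in> {?a..?b}"
    have "a \<in> I" "b \<in> I" using ab by auto
    then have "?a \<in> I" "?b \<in> I" using base by (simp_all add: min_def max_def)
    then show "z \<in> I" by (rule mem_is_interval_1_I[OF interval_I]) (use z in auto)
  qed
  have "(U has_vector_derivative T y) (at y within {?a..?b})"
    unfolding U_def[abs_def] using ab continuous_on_subset[OF continuous_on_T sub]
    by (intro interval_integral_FTC2) auto
  moreover have "at y within {?a..?b} = at y"
    using ab by (intro at_within_interior) (auto simp: interior_atLeastAtMost_real)
  ultimately show ?thesis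
    by (simp add: has_real_derivative_iff_has_vector_derivative)
qed

lemma U_subgradient:
  assumes "y \<in> I" "z \<in> I"
  shows "U y + T y * (z - y) \<le> U z"
proof -
  have sub: "x \<in> I" if "min y z \<le> x" "x \<le> max y z" for x
  proof (rule mem_is_interval_1_I[OF interval_I])
    show "min y z \<in> I" "max y z \<in> I" using assms by (simp_all add: min_def max_def)
  qed (use that in auto)
  consider "y = z" | "y < z" | "z < y" by linarith
  then show ?thesis
  proof cases
    case 2
    then obtain x where x: "y < x" "x < z" "U z - U y = (z - y) * T x"
      using MVT2[of y z U T] DERIV_U sub by auto
    have "T y \<le> T x" using x assms sub 2 by (intro T_mono) auto
    with x 2 show ?thesis
      using mult_left_mono[of "T y" "T x" "z - y"] by (simp add: algebra_simps)
  next
    case 3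
    then obtain x where x: "z < x" "x < y" "U y - U z = (y - z) * T x"
      using MVT2[of z y U T] DERIV_U sub by auto
    have "T x \<le> T y" using x assms sub 3 by (intro T_mono) auto
    with x 3 show ?thesis
      using mult_left_mono[of "T x" "T y" "y - z"] by (simp add: algebra_simps)
  qed simp
qed

definition S :: "real \<Rightarrow> real" where
  "S x = inv_into I T x"

lemma S_in_I: "S x \<in> I"
  unfolding S_def by (rule inv_into_into) (simp add: T_image)

lemma T_S: "T (S x) = x"
  unfolding S_def by (rule f_inv_into_f) (simp add: T_image)

lemma S_T: "y \<in> I \<Longrightarrow> S (T y) = y"
  using S_in_I T_S T_less by (metis linorder_cases less_irrefl)

lemma measurable_S[measurable]: "S \<in> borel_measurable borel"
proof (rule borel_measurable_mono)
  show "mono S"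
    by (rule monoI) (metis S_in_I T_S T_less not_le)
qed

definition U0 :: "real \<Rightarrow> real" where
  "U0 y = (if y \<in> I then U y else 0)"

lemma measurable_U0[measurable]: "U0 \<in> borel_measurable borel"
  unfolding U0_def[abs_def]
  by (rule borel_measurable_continuous_on_if)
    (auto intro!: continuous_at_imp_continuous_on DERIV_isCont DERIV_U)

text \<open>The convex conjugate of \<open>U\<close>.\<close>
definition V :: "real \<Rightarrow> real" where
  "V x = x * S x - U0 (S x)"

lemma measurable_V[measurable]: "V \<in> borel_measurable borel"
  unfolding V_def[abs_def] by simp

text \<open>The subgradient inequality for \<open>U\<close> at \<open>S x\<close>, where the slope
  is \<open>x\<close>.\<close>

lemma fenchel_young: "y \<in> I \<Longrightarrow> x * y \<le> U0 y + V x"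
  using U_subgradient[of "S x" y] S_in_I[of x] by (simp add: V_def U0_def T_S algebra_simps)

lemma fenchel_young_eq: "y \<in> I \<Longrightarrow> T y * y = U0 y + V (T y)"
  by (simp add: V_def S_T)

lemma U0_integrable: "integrable Q U0"
proof (rule Bochner_Integration.integrable_bound)
  \<comment> \<open>The subgradient inequality at \<open>base\<close> bounds \<open>U y\<close> from
    below, the one at \<open>y\<close> from above; both bounds are integrable.\<close>
  let ?l = "\<lambda>y. U base + T base * (y - base)" and ?u = "\<lambda>y. y * T0 y - T0 y * base + U base"
  show "integrable Q (\<lambda>y. \<bar>?l y\<bar> + \<bar>?u y\<bar>)"
    using Q.id_integrable T0_integrable T0_mult_integrable by simp
  show "AE y in Q. norm (U0 y) \<le> norm (\<bar>?l y\<bar> + \<bar>?u y\<bar>)"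
    using AE_I
  proof eventually_elim
    case (elim y)
    have "?l y \<le> U y" "U y \<le> ?u y"
      using U_subgradient[OF base elim] U_subgradient[OF elim base] elim
      by (simp_all add: T0_def algebra_simps)
    then show ?case using elim by (simp add: U0_def)
  qed
qed simp

lemma AE_U0_V: "AE y in Q. T0 y * y = U0 y + V (T0 y)"
  using AE_I by eventually_elim (simp add: T0_def fenchel_young_eq)

lemma V_T0_integrable: "integrable Q (\<lambda>y. V (T0 y))"
proof -
  have "integrable Q (\<lambda>y. y * T0 y - U0 y)"
    using U0_integrable T0_mult_integrable by simp
  then show ?thesis
    by (rule integrable_cong_AE_imp) (use AE_U0_V in \<open>auto simp: algebra_simps\<close>)
qed

lemma V_integrable: "integrable P V"
  using V_T0_integrable by (simp add: integrable_P_iff)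

lemma integral_U0_V: "(\<integral>y. U0 y \<partial>Q) + (\<integral>x. V x \<partial>P) = (\<integral>y. y * T0 y \<partial>Q)"
proof -
  have "(\<integral>x. V x \<partial>P) = (\<integral>y. V (T0 y) \<partial>Q)"
    by (rule integral_P) simp
  then have "(\<integral>y. U0 y \<partial>Q) + (\<integral>x. V x \<partial>P) = (\<integral>y. U0 y + V (T0 y) \<partial>Q)"
    using U0_integrable V_T0_integrable by simp
  also have "\<dots> = (\<integral>y. y * T0 y \<partial>Q)"
    by (rule integral_cong_AE) (use AE_U0_V in \<open>auto simp: mult.commute\<close>)
  finally show ?thesis .
qed

section \<open>Optimality of the monotone coupling\<close>

lemma T0_cost_integrable: "integrable Q (\<lambda>y. (T0 y - y)\<^sup>2)"
  unfolding power2_diff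
  using T0_sq_integrable Q.sq_integrable T0_mult_integrable
  by (simp add: mult.assoc mult.commute[of "T0 _"])

text \<open>The marginals fix the second moments, so minimal cost means maximal integral of
  \<open>x * y\<close>. Fenchel-Young bounds that integral by the integrals of \<open>U0\<close> and
  \<open>V\<close>, a bound that the monotone coupling attains.\<close>

lemma coupling_cost_ge:
  assumes \<pi>: "\<pi> \<in> couplings P Q"
  shows "ennreal (\<integral>y. (T0 y - y)\<^sup>2 \<partial>Q) \<le> (\<integral>\<^sup>+ (x, y). ennreal ((x - y)\<^sup>2) \<partial>\<pi>)"
proof -
  have [measurable_cong]: "sets \<pi> = sets (borel \<Otimes>\<^sub>M borel)"
    and P: "distr \<pi> borel fst = P" and Q: "distr \<pi> borel snd = Q"
    using \<pi> by (auto simp: couplings_def)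
  have [simp]: "fst \<in> borel_measurable \<pi>" "snd \<in> borel_measurable \<pi>"
    by simp_all
  have intP: "integrable \<pi> (\<lambda>w. f (fst w)) \<and> (\<integral>w. f (fst w) \<partial>\<pi>) = (\<integral>x. f x \<partial>P)"
    if "integrable P f" "f \<in> borel_measurable borel" for f :: "real \<Rightarrow> real"
    using that integrable_distr_eq[of fst \<pi> borel f] integral_distr[of fst \<pi> borel f] by (simp add: P)
  have intQ: "integrable \<pi> (\<lambda>w. f (snd w)) \<and> (\<integral>w. f (snd w) \<partial>\<pi>) = (\<integral>x. f x \<partial>Q)"
    if "integrable Q f" "f \<in> borel_measurable borel" for f :: "real \<Rightarrow> real"
    using that integrable_distr_eq[of snd \<pi> borel f] integral_distr[of snd \<pi> borel f] by (simp add: Q)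
  note x2 = intP[OF P.sq_integrable] and y2 = intQ[OF Q.sq_integrable]
    and u = intQ[OF U0_integrable] and v = intP[OF V_integrable]
  have xy: "integrable \<pi> (\<lambda>w. fst w * snd w)"
  proof (rule Bochner_Integration.integrable_bound)
    show "integrable \<pi> (\<lambda>w. (fst w)\<^sup>2 + (snd w)\<^sup>2)" using x2 y2 by simp
    show "AE w in \<pi>. norm (fst w * snd w) \<le> norm ((fst w)\<^sup>2 + (snd w)\<^sup>2)"
      by (intro AE_I2) (simp add: abs_mult_le_sum_squares)
  qed simp
  have "AE y in distr \<pi> borel snd. y \<in> I" unfolding Q by (rule AE_I)
  then have "AE w in \<pi>. snd w \<in> I" by (rule AE_distrD[rotated]) simp
  then have "AE w in \<pi>. fst w * snd w \<le> U0 (snd w) + V (fst w)"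
    by eventually_elim (rule fenchel_young)
  then have "(\<integral>w. fst w * snd w \<partial>\<pi>) \<le> (\<integral>w. U0 (snd w) + V (fst w) \<partial>\<pi>)"
    using xy u v by (intro integral_mono_AE) auto
  also have "\<dots> = (\<integral>y. y * T0 y \<partial>Q)"
    using u v integral_U0_V by simp
  finally have le: "(\<integral>w. fst w * snd w \<partial>\<pi>) \<le> (\<integral>y. y * T0 y \<partial>Q)" .
  have "(\<integral>y. (T0 y)\<^sup>2 \<partial>Q) = (\<integral>x. x\<^sup>2 \<partial>P)"
    by (rule integral_P[symmetric]) simp
  then have "(\<integral>y. (T0 y - y)\<^sup>2 \<partial>Q) = (\<integral>x. x\<^sup>2 \<partial>P) + (\<integral>y. y\<^sup>2 \<partial>Q) - 2 * (\<integral>y. y * T0 y \<partial>Q)"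
    unfolding power2_diff
    using T0_sq_integrable Q.sq_integrable T0_mult_integrable
    by (simp add: mult.assoc mult.commute[of "T0 _"])
  also have "\<dots> \<le> (\<integral>x. x\<^sup>2 \<partial>P) + (\<integral>y. y\<^sup>2 \<partial>Q) - 2 * (\<integral>w. fst w * snd w \<partial>\<pi>)"
    using le by simp
  also have "\<dots> = (\<integral>w. (fst w - snd w)\<^sup>2 \<partial>\<pi>)"
    unfolding power2_diff using x2 y2 xy by (simp add: mult.assoc)
  finally have "ennreal (\<integral>y. (T0 y - y)\<^sup>2 \<partial>Q) \<le> ennreal (\<integral>w. (fst w - snd w)\<^sup>2 \<partial>\<pi>)"
    by (rule ennreal_leI)
  also have "\<dots> = (\<integral>\<^sup>+ w. ennreal ((fst w - snd w)\<^sup>2) \<partial>\<pi>)"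
  proof (rule nn_integral_eq_integral[symmetric])
    show "integrable \<pi> (\<lambda>w. (fst w - snd w)\<^sup>2)"
      using x2 y2 xy by (simp add: power2_diff mult.assoc)
  qed simp
  finally show ?thesis by (simp add: split_beta')
qed

lemma W2_sq_eq: "W2_sq P Q = (\<integral>y. (T0 y - y)\<^sup>2 \<partial>Q)"
proof (rule antisym)
  show "W2_sq P Q \<le> (\<integral>y. (T0 y - y)\<^sup>2 \<partial>Q)"
    by (rule W2_sq_le_coupling[OF _ _ distr_T0 _ T0_cost_integrable]) (auto simp: distr_id2)
  \<comment> \<open>This coupling of finite cost keeps the infimum below \<open>\<infinity>\<close>,
    which \<open>enn2real\<close> would send to 0.\<close>
  have ne: "distr Q (borel \<Otimes>\<^sub>M borel) (\<lambda>y. (T0 y, y)) \<in> couplings P Q"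
    unfolding couplings_def by (auto simp: distr_distr comp_def distr_id2 distr_T0)
  have "(\<integral>\<^sup>+ (x, y). ennreal ((x - y)\<^sup>2) \<partial>distr Q (borel \<Otimes>\<^sub>M borel) (\<lambda>y. (T0 y, y))) =
      (\<integral>\<^sup>+y. ennreal ((T0 y - y)\<^sup>2) \<partial>Q)"
    by (subst nn_integral_distr) (auto simp: split_beta')
  also have "\<dots> < \<infinity>"
    using nn_integral_eq_integral[OF T0_cost_integrable] by simp
  finally have fin: "(INF \<pi>\<in>couplings P Q. \<integral>\<^sup>+ (x, y). ennreal ((x - y)\<^sup>2) \<partial>\<pi>) < top"
    using INF_lower[OF ne] by (metis (no_types, lifting) infinity_ennreal_def le_less_trans)
  have "ennreal (\<integral>y. (T0 y - y)\<^sup>2 \<partial>Q) \<le> (INF \<pi>\<in>couplings P Q. \<integral>\<^sup>+ (x, y). ennreal ((x - y)\<^sup>2) \<partial>\<pi>)"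
    by (rule INF_greatest) (rule coupling_cost_ge)
  from enn2real_mono[OF this fin] show "(\<integral>y. (T0 y - y)\<^sup>2 \<partial>Q) \<le> W2_sq P Q"
    unfolding W2_sq_def by simp
qed

text \<open>Complementary slackness: the gap \<open>?D\<close> is nonnegative and integrates to 0,
  so it vanishes almost everywhere. The bound by the c-transform at \<open>T y\<close> then holds
  for every \<open>z\<close> and is tight at \<open>y\<close>.\<close>

lemma kantorovich_potential_subgradient:
  assumes "kantorovich_potential Q P \<phi>"
  shows "AE y in Q. \<bar>\<phi> y\<bar> \<noteq> \<infinity> \<and>
    (\<forall>z. \<phi> z \<le> ereal (real_of_ereal (\<phi> y) + (T y - z)\<^sup>2 / 2 - (T y - y)\<^sup>2 / 2))"
proof -
  let ?f = "\<lambda>y. real_of_ereal (\<phi> y)" and ?g = "\<lambda>x. real_of_ereal (c_transform \<phi> x)"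
  have conc: "c_concave \<phi>" and f: "AE y in Q. \<bar>\<phi> y\<bar> \<noteq> \<infinity>" "integrable Q ?f"
    and g: "AE x in P. \<bar>c_transform \<phi> x\<bar> \<noteq> \<infinity>" "integrable P ?g"
    and dual: "W2_sq P Q / 2 = (\<integral>y. ?f y \<partial>Q) + (\<integral>x. ?g x \<partial>P)"
    using assms by (auto simp: kantorovich_potential_def)
  have not_inf: "\<phi> z \<noteq> \<infinity>" for z
    using conc by (simp add: c_concave_def)
  have [measurable]: "?g \<in> borel_measurable borel"
    using borel_measurable_integrable[OF g(2)] by simp
  have gT: "integrable Q (\<lambda>y. ?g (T0 y))"
    using g(2) by (simp add: integrable_P_iff)
  have "AE x in distr Q borel T0. \<bar>c_transform \<phi> x\<bar> \<noteq> \<infinity>"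
    unfolding distr_T0 by (rule g(1))
  then have gfin: "AE y in Q. \<bar>c_transform \<phi> (T0 y)\<bar> \<noteq> \<infinity>"
    by (rule AE_distrD[rotated]) simp
  have le: "\<phi> z \<le> ereal ((x - z)\<^sup>2 / 2 - ?g x)" if "\<bar>c_transform \<phi> x\<bar> \<noteq> \<infinity>" for x z
  proof -
    have "c_transform \<phi> x \<le> ereal ((x - z)\<^sup>2 / 2) - \<phi> z"
      unfolding c_transform_def by (rule INF_lower) simp
    then show ?thesis
      using that not_inf[of z] by (cases "\<phi> z"; cases "c_transform \<phi> x") auto
  qed
  let ?D = "\<lambda>y. (T0 y - y)\<^sup>2 / 2 - ?f y - ?g (T0 y)"
  have D: "integrable Q ?D"
    using f(2) gT T0_cost_integrable by simp
  have D_nonneg: "AE y in Q. 0 \<le> ?D y"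
    using f(1) gfin
  proof eventually_elim
    case (elim y)
    then show ?case using le[of "T0 y" y] by (cases "\<phi> y") auto
  qed
  have "(\<integral>x. ?g x \<partial>P) = (\<integral>y. ?g (T0 y) \<partial>Q)"
    by (rule integral_P) simp
  then have "(\<integral>y. ?D y \<partial>Q) = 0"
    using f(2) gT T0_cost_integrable dual by (simp add: W2_sq_eq add_divide_distrib)
  then have "AE y in Q. ?D y = 0"
    using integral_nonneg_eq_0_iff_AE[OF D D_nonneg] by simp
  then show ?thesis
    using f(1) gfin AE_T0
  proof eventually_elim
    case (elim y)
    have eq: "?f y + (T y - z)\<^sup>2 / 2 - (T y - y)\<^sup>2 / 2 = (T y - z)\<^sup>2 / 2 - ?g (T y)" for z
      using elim by simp
    show ?case
      unfolding eq using elim le[of "T y"] by simp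
  qed
qed

subsection \<open>The Euler--Lagrange equation\<close>

lemma AE_ex_in_interval:
  assumes "AE y in Q. R y" "a \<in> I" "b \<in> I" "a < b"
  obtains y where "a < y" "y \<le> b" "R y"
proof -
  have "measure Q {a<..b} > 0"
    using Q.cdf_diff_eq[OF assms(4)] cdf_Q_less[OF assms(2-4)] by simp
  have "\<not> (AE y in Q. y \<notin> {a<..b})"
  proof
    assume "AE y in Q. y \<notin> {a<..b}"
    then have "measure Q {a<..b} = 0" by (subst Q.prob_eq_0) auto
    with \<open>measure Q {a<..b} > 0\<close> show False by simp
  qed
  then have "\<exists>y. y \<in> {a<..b} \<and> R y"
    using assms(1) by (metis (mono_tags, lifting) eventually_mono)
  then show thesis using that by auto
qed

lemma second_moment_law_translate_on_interval:
  "second_moment_law (distr Q borel (\<lambda>y. if y \<in> {a..b} then y + h else y))" (is "second_moment_law ?R")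
proof -
  let ?g = "\<lambda>y. if y \<in> {a..b} then y + h else y"
  have "integrable Q (\<lambda>y. (?g y)\<^sup>2)"
  proof (rule Bochner_Integration.integrable_bound)
    show "integrable Q (\<lambda>y. y\<^sup>2 + (\<bar>y\<bar> + \<bar>h\<bar>)\<^sup>2)"
      unfolding power2_sum using Q.sq_integrable Q.id_integrable by simp
    show "AE y in Q. norm ((?g y)\<^sup>2) \<le> norm (y\<^sup>2 + (\<bar>y\<bar> + \<bar>h\<bar>)\<^sup>2)"
    proof (rule AE_I2)
      fix y
      have "(y + h)\<^sup>2 \<le> (\<bar>y\<bar> + \<bar>h\<bar>)\<^sup>2"
        using abs_triangle_ineq[of y h] by (intro abs_le_square_iff[THEN iffD1]) auto
      then show "norm ((?g y)\<^sup>2) \<le> norm (y\<^sup>2 + (\<bar>y\<bar> + \<bar>h\<bar>)\<^sup>2)"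
        by (auto intro: add_increasing)
    qed
  qed simp
  moreover have "real_distribution ?R"
    by (rule Q.real_distribution_distr) simp
  ultimately show ?thesis
    by (simp add: second_moment_law_def second_moment_law_axioms_def integrable_distr_eq)
qed

text \<open>
  Moving the mass of a short interval around \<open>y0\<close> by \<open>h\<close> changes the Wasserstein cost at most as
  the transported coupling does, and the estimation error at most as for the estimator that is
  optimal for \<open>Q\<close>. Both bounds are sharp at \<open>h = 0\<close>.
\<close>
lemma euler_lagrange:
  assumes k: "k > 0"
    and min: "\<And>R. second_moment_law R \<Longrightarrow> J k P Q \<le> J k P R"
    and y0: "y0 \<in> I"
  shows "2 * k\<^sup>2 * (y0 - T y0) + Q.risk' y0 = 0"
proof (rule ccontr)
  define D where "D = 2 * k\<^sup>2 * (y0 - T y0) + Q.risk' y0"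
  assume "2 * k\<^sup>2 * (y0 - T y0) + Q.risk' y0 \<noteq> 0"
  then have D: "\<bar>D\<bar> / 4 > 0" by (simp add: D_def)
  have "continuous_on I (\<lambda>y. 2 * k\<^sup>2 * (y - T y))"
    by (intro continuous_intros continuous_on_T)
  then have "isCont (\<lambda>y. 2 * k\<^sup>2 * (y - T y)) y0"
    using open_I y0 by (simp add: continuous_on_eq_continuous_at)
  then obtain d1 where d1: "d1 > 0"
    "\<And>y. \<bar>y - y0\<bar> < d1 \<Longrightarrow> \<bar>2 * k\<^sup>2 * (y - T y) - 2 * k\<^sup>2 * (y0 - T y0)\<bar> < \<bar>D\<bar> / 4"
    using D unfolding continuous_at_eps_delta dist_real_def by blast
  obtain d2 where d2: "d2 > 0" "\<And>y. \<bar>y - y0\<bar> < d2 \<Longrightarrow> \<bar>Q.risk' y - Q.risk' y0\<bar> < \<bar>D\<bar> / 4"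
    using Q.isCont_risk'[of y0] D unfolding continuous_at_eps_delta dist_real_def by blast
  obtain a b where ab: "a < y0" "y0 < b" "{a..b} \<subseteq> I"
    using open_I_around[OF y0] .
  \<comment> \<open>\<open>T\<close> is evaluated within \<delta> of \<open>y0\<close>, but
    \<open>Q.risk'\<close> at an intermediate point of the shift, up to
    \<open>\<delta> + \<epsilon> \<le> 2 * \<delta>\<close> away; hence the smaller fraction of
    \<open>d2\<close>.\<close>
  define \<delta> where "\<delta> = Min {d1 / 2, d2 / 3, y0 - a, b - y0}"
  have \<delta>: "\<delta> > 0" "\<delta> < d1" "2 * \<delta> < d2" "\<delta> \<le> y0 - a" "\<delta> \<le> b - y0"
    using d1(1) d2(1) ab unfolding \<delta>_def by (auto simp: min_def)
  \<comment> \<open>The second bound makes the second-order term of the transport cost negligible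
    against \<open>D\<close>.\<close>
  define \<epsilon> where "\<epsilon> = min \<delta> (\<bar>D\<bar> / (8 * k\<^sup>2))"
  have \<epsilon>: "\<epsilon> > 0" "\<epsilon> \<le> \<delta>" "k\<^sup>2 * \<epsilon> < \<bar>D\<bar> / 4"
  proof -
    have "k\<^sup>2 * \<epsilon> \<le> k\<^sup>2 * (\<bar>D\<bar> / (8 * k\<^sup>2))"
      unfolding \<epsilon>_def by (intro mult_left_mono) auto
    also have "\<dots> < \<bar>D\<bar> / 4" using k D by simp
    finally show "k\<^sup>2 * \<epsilon> < \<bar>D\<bar> / 4" .
  qed (use k D \<delta> in \<open>auto simp: \<epsilon>_def\<close>)
  \<comment> \<open>The shift goes against the sign of the first-order change
    \<open>D\<close>.\<close>
  define h where "h = - sgn D * \<epsilon>"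
  have h: "\<bar>h\<bar> = \<epsilon>" using \<epsilon>(1) D by (simp add: h_def abs_mult abs_sgn_eq)
  let ?K = "{y0 - \<delta>..y0 + \<delta>}"
  define g where "g y = (if y \<in> ?K then y + h else y)" for y
  define R where "R = distr Q borel g"
  have [measurable]: "g \<in> borel_measurable borel" unfolding g_def[abs_def] by simp
  have KI: "?K \<subseteq> I" using ab \<delta> by (auto intro!: subsetD[OF ab(3)])
  have R: "second_moment_law R"
    unfolding R_def g_def[abs_def] by (rule second_moment_law_translate_on_interval)
  then interpret R: second_moment_law R .
  have g_sq: "integrable Q (\<lambda>y. (g y)\<^sup>2)"
    using R.sq_integrable unfolding R_def by (simp add: integrable_distr_eq)
  have cost: "integrable Q (\<lambda>y. (T0 y - g y)\<^sup>2)"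
  proof (rule Bochner_Integration.integrable_bound)
    show "integrable Q (\<lambda>y. 2 * (T0 y)\<^sup>2 + 2 * (g y)\<^sup>2)"
      using g_sq T0_sq_integrable by simp
    show "AE y in Q. norm ((T0 y - g y)\<^sup>2) \<le> norm (2 * (T0 y)\<^sup>2 + 2 * (g y)\<^sup>2)"
    proof (rule AE_I2)
      fix y
      have "0 \<le> (T0 y + g y)\<^sup>2" by simp
      then have "(T0 y - g y)\<^sup>2 \<le> 2 * (T0 y)\<^sup>2 + 2 * (g y)\<^sup>2"
        unfolding power2_sum power2_diff by linarith
      then show "norm ((T0 y - g y)\<^sup>2) \<le> norm (2 * (T0 y)\<^sup>2 + 2 * (g y)\<^sup>2)"
        by simp
    qed
  qed simp
  have [measurable]: "Q.risk \<in> borel_measurable borel"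
    using DERIV_isCont[OF Q.DERIV_risk]
    by (intro borel_measurable_continuous_onI continuous_at_imp_continuous_on) blast
  have risk_g: "integrable Q (\<lambda>y. Q.risk (g y))" "(\<integral>y. Q.risk y \<partial>R) = (\<integral>y. Q.risk (g y) \<partial>Q)"
    using Q.integral_risk(1)[OF R] unfolding R_def
    by (simp_all add: integrable_distr_eq integral_distr)
  have risk: "integrable Q Q.risk"
    by (rule Q.integral_risk(1)[OF Q.second_moment_law_axioms])
  define \<Delta> where "\<Delta> y = k\<^sup>2 * ((T0 y - g y)\<^sup>2 - (T0 y - y)\<^sup>2) + (Q.risk (g y) - Q.risk y)" for y
  have "W2_sq P R \<le> (\<integral>y. (T0 y - g y)\<^sup>2 \<partial>Q)"
    by (rule W2_sq_le_coupling[OF _ _ distr_T0 _ cost]) (simp_all add: R_def)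
  then have "J k P R \<le> k\<^sup>2 * (\<integral>y. (T0 y - g y)\<^sup>2 \<partial>Q) + (\<integral>y. Q.risk (g y) \<partial>Q)"
    using Q.mmse_le_risk[OF R] unfolding J_def risk_g(2) by (intro add_mono mult_left_mono) auto
  moreover have "J k P Q = k\<^sup>2 * (\<integral>y. (T0 y - y)\<^sup>2 \<partial>Q) + (\<integral>y. Q.risk y \<partial>Q)"
    by (simp add: J_def W2_sq_eq Q.mmse_eq_risk)
  moreover have "(\<integral>y. \<Delta> y \<partial>Q) = k\<^sup>2 * ((\<integral>y. (T0 y - g y)\<^sup>2 \<partial>Q) - (\<integral>y. (T0 y - y)\<^sup>2 \<partial>Q)) +
      ((\<integral>y. Q.risk (g y) \<partial>Q) - (\<integral>y. Q.risk y \<partial>Q))"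
    unfolding \<Delta>_def using cost T0_cost_integrable risk_g(1) risk
    by (subst Bochner_Integration.integral_add) simp_all
  ultimately have "0 \<le> (\<integral>y. \<Delta> y \<partial>Q)"
    using min[OF R] by (simp add: algebra_simps)
  also have "\<dots> \<le> (\<integral>y. indicator ?K y * (- (\<epsilon> * (\<bar>D\<bar> / 4))) \<partial>Q)"
  proof (rule integral_mono)
    show "integrable Q \<Delta>"
      unfolding \<Delta>_def[abs_def] using cost T0_cost_integrable risk_g(1) risk by simp
    show "integrable Q (\<lambda>y. indicator ?K y * (- (\<epsilon> * (\<bar>D\<bar> / 4))))"
      by (intro integrable_mult_left integrable_real_indicator) (simp_all add: Q.emeasure_finite less_top[symmetric])
    fix y
    show "\<Delta> y \<le> indicator ?K y * (- (\<epsilon> * (\<bar>D\<bar> / 4)))"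
    proof (cases "y \<in> ?K")
      case False
      then have "g y = y" unfolding g_def by (rule if_not_P)
      then show ?thesis using False by (simp add: \<Delta>_def)
    next
      case True
      have y: "\<bar>y - y0\<bar> \<le> \<delta>" using True by (auto simp: abs_le_iff)
      have "T0 y = T y" using True KI by (auto simp: T0_def)
      obtain \<theta> where \<theta>: "\<bar>\<theta> - y\<bar> \<le> \<epsilon>" "Q.risk (y + h) - Q.risk y = h * Q.risk' \<theta>"
      proof (cases "h > 0")
        case True
        then obtain z where "y < z" "z < y + h" "Q.risk (y + h) - Q.risk y = (y + h - y) * Q.risk' z"
          using MVT2[of y "y + h" Q.risk Q.risk'] Q.DERIV_risk by auto
        then show thesis using h True by (intro that[of z]) auto
      next
        case False
        then have "h < 0" using h \<epsilon>(1) by auto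
        then obtain z where "y + h < z" "z < y" "Q.risk y - Q.risk (y + h) = (y - (y + h)) * Q.risk' z"
          using MVT2[of "y + h" y Q.risk Q.risk'] Q.DERIV_risk by auto
        then show thesis using h \<open>h < 0\<close> by (intro that[of z]) auto
      qed
      define B where "B = 2 * k\<^sup>2 * (y - T y) + Q.risk' \<theta> + k\<^sup>2 * h"
      have "\<Delta> y = h * B"
        using \<open>T0 y = T y\<close> True \<theta>(2) unfolding \<Delta>_def g_def B_def
        by (simp add: power2_eq_square algebra_simps)
      \<comment> \<open>Three errors below a quarter of \<open>\<bar>D\<bar>\<close> leave
        \<open>B\<close> with the sign of \<open>D\<close> and at least a quarter of its
        modulus.\<close>
      moreover have "\<bar>B - D\<bar> \<le> 3 * (\<bar>D\<bar> / 4)"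
      proof -
        have "\<bar>2 * k\<^sup>2 * (y - T y) - 2 * k\<^sup>2 * (y0 - T y0)\<bar> < \<bar>D\<bar> / 4"
          using y \<delta> by (intro d1) auto
        moreover have "\<bar>Q.risk' \<theta> - Q.risk' y0\<bar> < \<bar>D\<bar> / 4"
          using y \<theta>(1) \<delta> \<epsilon> by (intro d2) auto
        moreover have "\<bar>k\<^sup>2 * h\<bar> < \<bar>D\<bar> / 4"
          using \<epsilon>(3) by (simp add: abs_mult h)
        ultimately show ?thesis
          unfolding B_def D_def by linarith
      qed
      then have "\<bar>D\<bar> / 4 \<le> sgn D * B"
        by (cases "D > 0") (auto simp: sgn_real_def abs_if split: if_splits)
      then have "\<epsilon> * (\<bar>D\<bar> / 4) \<le> \<epsilon> * (sgn D * B)"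
        using \<epsilon>(1) by (intro mult_left_mono) auto
      then have "h * B \<le> - (\<epsilon> * (\<bar>D\<bar> / 4))"
        unfolding h_def by (simp add: mult_ac)
      ultimately show ?thesis using True by simp
    qed
  qed
  also have "\<dots> = - (measure Q ?K * (\<epsilon> * (\<bar>D\<bar> / 4)))"
    by simp
  finally have "measure Q ?K * (\<epsilon> * (\<bar>D\<bar> / 4)) \<le> 0" by simp
  moreover have "measure Q ?K > 0"
  proof -
    have "0 < cdf Q (y0 + \<delta>) - cdf Q (y0 - \<delta>)"
      using cdf_Q_less[of "y0 - \<delta>" "y0 + \<delta>"] \<delta>(1) KI[THEN subsetD] by simp
    also have "\<dots> = measure Q {y0 - \<delta><..y0 + \<delta>}"
      using \<delta> by (intro Q.cdf_diff_eq) auto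
    also have "\<dots> \<le> measure Q ?K"
      by (intro Q.finite_measure_mono) auto
    finally show ?thesis .
  qed
  ultimately show False
    using mult_pos_pos[OF _ mult_pos_pos[OF \<epsilon>(1) D]] by fastforce
qed

text \<open>
  If \<open>I\<close> had a finite endpoint, the Euler--Lagrange equation would keep \<open>T\<close> bounded near it,
  although \<open>T\<close> maps \<open>I\<close> onto the whole line.
\<close>
lemma I_eq_UNIV:
  assumes k: "k > 0" and EL: "\<And>y. y \<in> I \<Longrightarrow> 2 * k\<^sup>2 * (y - T y) + Q.risk' y = 0"
  shows "I = UNIV"
proof (rule ccontr)
  assume "I \<noteq> UNIV"
  then obtain r where r: "r \<notin> I" by auto
  let ?S = "{min base r..max base r}"
  have "bounded (Q.risk' ` ?S)"
    using Q.isCont_risk'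
    by (intro compact_imp_bounded compact_continuous_image continuous_at_imp_continuous_on) auto
  then obtain C where C: "\<And>y. y \<in> ?S \<Longrightarrow> \<bar>Q.risk' y\<bar> \<le> C"
    unfolding bounded_iff by (metis imageI real_norm_def)
  \<comment> \<open>Solving the Euler--Lagrange equation for \<open>T y\<close> gives this bound on
    the part of \<open>I\<close> between \<open>base\<close> and the missing point
    \<open>r\<close>.\<close>
  define c where "c = \<bar>base\<bar> + \<bar>r\<bar> + C / (2 * k\<^sup>2)"
  have T_le: "\<bar>T y\<bar> \<le> c" if "y \<in> I" "y \<in> ?S" for y
  proof -
    have "T y = y + Q.risk' y / (2 * k\<^sup>2)"
      using EL[OF that(1)] k by (simp add: field_simps)
    moreover have "\<bar>Q.risk' y / (2 * k\<^sup>2)\<bar> \<le> C / (2 * k\<^sup>2)"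
      using C[OF that(2)] k by (simp add: divide_right_mono)
    moreover have "\<bar>y\<bar> \<le> \<bar>base\<bar> + \<bar>r\<bar>"
      using that(2) by (auto simp: min_def max_def split: if_splits)
    ultimately show ?thesis
      unfolding c_def by linarith
  qed
  have "base \<noteq> r" using r base by auto
  then consider "base < r" | "r < base" by linarith
  then show False
  proof cases
    case 1
    \<comment> \<open>This preimage lies between \<open>base\<close> and \<open>r\<close>: the
      interval \<open>I\<close> cannot pass \<open>r\<close>, and left of \<open>base\<close> the
      increasing \<open>T\<close> stays below \<open>c\<close>.\<close>
    obtain y where y: "y \<in> I" "T y = c + 1" by (rule T_surj)
    have "\<not> r \<le> y"
      using r 1 mem_is_interval_1_I[OF interval_I base y(1), of r] by auto
    moreover have "base \<le> y"
      using y T_less[OF y(1) base] T_le[OF base] by force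
    ultimately have "\<bar>T y\<bar> \<le> c" using y by (intro T_le) auto
    with y show False by simp
  next
    case 2
    obtain y where y: "y \<in> I" "T y = - c - 1" by (rule T_surj)
    have "\<not> y \<le> r"
      using r 2 mem_is_interval_1_I[OF interval_I y(1) base, of r] by auto
    moreover have "y \<le> base"
      using y T_less[OF base y(1)] T_le[OF base] by force
    ultimately have "\<bar>T y\<bar> \<le> c" using y by (intro T_le) auto
    with y show False by simp
  qed
qed

lemma potential_plus_risk_constant:
  assumes k: "k > 0" and I: "I = UNIV"
    and EL: "\<And>y. 2 * k\<^sup>2 * (y - T y) + Q.risk' y = 0"
    and pot: "kantorovich_potential Q P \<phi>"
  obtains l where "\<And>y. ereal (2 * k\<^sup>2) * \<phi> y + ereal (Q.risk y) = ereal l"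
proof -
  define A where "A = {y. \<bar>\<phi> y\<bar> \<noteq> \<infinity> \<and>
    (\<forall>z. \<phi> z \<le> ereal (real_of_ereal (\<phi> y) + (T y - z)\<^sup>2 / 2 - (T y - y)\<^sup>2 / 2))}"
  have AE: "AE y in Q. y \<in> A"
    unfolding A_def using kantorovich_potential_subgradient[OF pot] by simp
  \<comment> \<open>\<open>A\<close> has full \<open>Q\<close>-measure and \<open>Q\<close> charges
    every interval.\<close>
  have "closure A = UNIV"
  proof -
    have "x \<in> closure A" for x
      unfolding closure_approachable
    proof (intro allI impI)
      fix e :: real assume "0 < e"
      then obtain y where "x - e < y" "y \<le> x" "y \<in> A"
        using AE_ex_in_interval[OF AE, of "x - e" x] I by auto
      then show "\<exists>y\<in>A. dist y x < e"
        by (intro bexI[of _ y]) (auto simp: dist_real_def)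
    qed
    then show ?thesis by auto
  qed
  moreover have "c_concave \<phi>"
    using pot by (simp add: kantorovich_potential_def)
  moreover have "continuous_on UNIV T"
    using continuous_on_T by (simp add: I)
  moreover have "\<bar>\<phi> y\<bar> \<noteq> \<infinity>"
    "\<phi> z \<le> ereal (real_of_ereal (\<phi> y) + (T y - z)\<^sup>2 / 2 - (T y - y)\<^sup>2 / 2)" if "y \<in> A" for y z
    using that unfolding A_def by simp_all
  ultimately obtain f where f: "\<And>y. \<phi> y = ereal (f y)"
    and Df: "\<And>y. (f has_real_derivative y - T y) (at y)"
    using c_concave_DERIV[of \<phi> A T] by metis
  define L where "L y = 2 * k\<^sup>2 * f y + Q.risk y" for y
  have "(L has_real_derivative 0) (at y)" for y
    unfolding L_def[abs_def] EL[of y, symmetric]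
    by (intro DERIV_add DERIV_cmult Df Q.DERIV_risk)
  then have "L y = L 0" for y
    by (intro DERIV_isconst_all) auto
  then show thesis
    by (intro that[of "L 0"]) (simp add: f L_def)
qed

end

subsection \<open>Densities and supports\<close>

lemma has_density_null:
  assumes "has_density Q q" "N \<in> null_sets lborel"
  shows "emeasure Q N = 0"
proof -
  have [measurable]: "q \<in> borel_measurable borel" and Q: "Q = density lborel (\<lambda>x. ennreal (q x))"
    using assms(1) by (auto simp: has_density_def)
  have "AE x in lborel. ennreal (q x) * indicator N x = 0"
    using AE_not_in[OF assms(2)] by eventually_elim simp
  moreover have [measurable]: "N \<in> sets lborel" using assms(2) by auto
  ultimately show ?thesis
    unfolding Q by (simp add: emeasure_density nn_integral_0_iff_AE)
qed

lemma (in real_distribution) has_density_isCont_cdf: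
  assumes "has_density M q"
  shows "isCont (cdf M) x"
  unfolding isCont_cdf measure_def
  using has_density_null[OF assms, of "{x}"] by (simp add: null_sets_def)

lemma (in real_distribution) has_density_strict_mono_cdf:
  assumes "has_density M p" "\<And>x. 0 < p x"
  shows "strict_mono (cdf M)"
proof (rule strict_monoI)
  fix a b :: real assume ab: "a < b"
  have [measurable]: "p \<in> borel_measurable borel" and M: "M = density lborel (\<lambda>x. ennreal (p x))"
    using assms(1) by (auto simp: has_density_def)
  have "measure M {a<..b} \<noteq> 0"
  proof
    assume "measure M {a<..b} = 0"
    then have "emeasure M {a<..b} = 0" by (simp add: emeasure_eq_measure)
    then have "(\<integral>\<^sup>+x. ennreal (p x) * indicator {a<..b} x \<partial>lborel) = 0"
      unfolding M by (subst (asm) emeasure_density) auto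
    then have "AE x in lborel. ennreal (p x) * indicator {a<..b} x = 0"
      by (subst (asm) nn_integral_0_iff_AE) auto
    then have "AE x in lborel. x \<notin> {a<..b}"
    proof eventually_elim
      case (elim x)
      then show ?case using assms(2)[of x] by (auto simp: indicator_def split: if_splits)
    qed
    then have "{a<..b} \<in> null_sets lborel"
      by (subst (asm) AE_iff_null_sets[symmetric]) auto
    then show False using ab by (simp add: null_sets_def)
  qed
  then show "cdf M a < cdf M b"
    using cdf_diff_eq[OF ab] measure_nonneg[of M "{a<..b}"] by linarith
qed

text \<open>By Lindelof, countably many open null sets cover the complement of the support.\<close>

lemma (in real_distribution) AE_measure_support: "AE x in M. x \<in> measure_support M"
proof -
  let ?\<F> = "{U. open U \<and> emeasure M U = 0}"
  obtain \<G> where \<G>: "\<G> \<subseteq> ?\<F>" "countable \<G>" "\<Union>\<G> = \<Union>?\<F>"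
    using Lindelof[of ?\<F>] by auto
  have "AE x in M. \<forall>U\<in>\<G>. x \<notin> U"
  proof (subst AE_ball_countable[OF \<G>(2)], intro ballI AE_not_in)
    fix U assume "U \<in> \<G>"
    then show "U \<in> null_sets M" using \<G>(1) by (auto simp: null_sets_def)
  qed
  then show ?thesis
  proof eventually_elim
    case (elim x)
    then have "x \<notin> \<Union>?\<F>" unfolding \<G>(3)[symmetric] by auto
    then show ?case by (auto simp: measure_support_def zero_less_iff_neq_zero)
  qed
qed

text \<open>The frontier of a convex set is Lebesgue-null, and a law with a density does not charge
  it.\<close>

lemma (in real_distribution) AE_interior_measure_support:
  assumes "has_density M q" "is_interval (measure_support M)"
  shows "AE x in M. x \<in> interior (measure_support M)"
proof -
  let ?S = "measure_support M"
  have "convex ?S" using assms(2) by (simp add: is_interval_convex_1)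
  then have "negligible (frontier ?S)" by (rule negligible_convex_frontier)
  then have "frontier ?S \<in> null_sets lborel"
    using frontier_closed[of ?S]
    by (simp add: negligible_iff_null_sets null_sets_completion_iff borel_closed)
  then have "emeasure M (frontier ?S) = 0" by (rule has_density_null[OF assms(1)])
  then have "frontier ?S \<in> null_sets M"
    using frontier_closed[of ?S] by (auto simp: null_sets_def borel_closed)
  then have "AE x in M. x \<notin> frontier ?S" by (rule AE_not_in)
  with AE_measure_support show ?thesis
  proof eventually_elim
    case (elim x)
    then show ?case using closure_subset[of ?S] by (auto simp: frontier_def)
  qed
qed

text \<open>A point \<open>c\<close> slightly to the right of \<open>a\<close> is still in the
  support, so its neighbourhood \<open>{a<..<b}\<close> has positive mass.\<close>

lemma (in real_distribution) cdf_less_support: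
  assumes "a \<in> interior (measure_support M)" "a < b"
    and "isCont (cdf M) b"
  shows "cdf M a < cdf M b"
proof -
  obtain e where e: "e > 0" "ball a e \<subseteq> measure_support M"
    using assms(1) by (auto simp: mem_interior)
  define c where "c = min (a + e / 2) ((a + b) / 2)"
  have c: "a < c" "c < b" "c < a + e"
    using e assms(2) by (auto simp: c_def min_def field_simps)
  then have "c \<in> measure_support M"
    by (intro subsetD[OF e(2)]) (simp add: dist_real_def)
  then have "0 < emeasure M {a<..<b}"
    using c unfolding measure_support_def by auto
  also have "\<dots> \<le> emeasure M {a<..b}"
    by (intro emeasure_mono) auto
  finally have "0 < measure M {a<..b}"
    by (simp add: emeasure_eq_measure)
  then show ?thesis
    using cdf_diff_eq[OF assms(2)] by simp
qed

lemma P2_iff: "R \<in> P2 \<longleftrightarrow> second_moment_law R"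
  by (simp add: P2_def second_moment_law_def second_moment_law_axioms_def)

section \<open>Optimality conditions for the minimizer\<close>

theorem theorem3p12:
  fixes k :: real
    and P Q :: "real measure"
    and p q pZ s m a b T :: "real \<Rightarrow> real"
    and \<phi> \<Lambda> :: "real \<Rightarrow> ereal"
  assumes k: "k > 0"
    and P: "P \<in> P2"
    and p: "has_density P p" "smooth_on_open UNIV p" "\<And>x. 0 < p x"
    and Q: "is_arg_min (J k P) (\<lambda>R. R \<in> P2) Q"
    and supp: "is_interval (measure_support Q)"
    and q: "has_density Q q" "smooth_on_open (interior (measure_support Q)) q"
      "\<And>y. y \<in> interior (measure_support Q) \<Longrightarrow> 0 < q y"
    and pZ: "pZ = conv_measure Q"
    and s: "s = deriv (\<lambda>z. ln (pZ z))"
    and m: "posterior_mean Q m"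
    and a: "a = (\<lambda>y. \<integral>z. m z * std_normal_density (z - y) \<partial>lborel)"
    and b: "b = (\<lambda>y. \<integral>z. (m z)\<^sup>2 * std_normal_density (z - y) \<partial>lborel)"
    and T: "T = quantile P \<circ> cdf Q"
    and \<phi>: "kantorovich_potential Q P \<phi>"
    and \<Lambda>: "\<Lambda> = (\<lambda>y. ereal (2 * k\<^sup>2) * \<phi> y + ereal (y\<^sup>2 - 2 * y * a y + b y))"
  shows "\<exists>l::real.
      (AE y in Q. \<Lambda> y = ereal l) \<and>
      (AE y in lborel. \<Lambda> y \<ge> ereal l) \<and>
      (\<forall>y\<in>measure_support Q. \<Lambda> y = ereal l) \<and>
      (\<forall>y. q y > 0 \<longrightarrow>
         conv_fun (\<lambda>z. 2 * deriv s z + (s z)\<^sup>2) differentiable (at y) \<and>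
         2 * k\<^sup>2 * (y - T y) + deriv (conv_fun (\<lambda>z. 2 * deriv s z + (s z)\<^sup>2)) y = 0 \<and>
         (\<lambda>y. y\<^sup>2 - 2 * y * a y + b y) differentiable (at y) \<and>
         2 * k\<^sup>2 * (y - T y) + deriv (\<lambda>y. y\<^sup>2 - 2 * y * a y + b y) y = 0)"
proof -
  have Q_mem: "second_moment_law Q" and min: "\<And>R. second_moment_law R \<Longrightarrow> J k P Q \<le> J k P R"
    using Q by (auto simp: is_arg_min_def P2_iff not_less)
  interpret Q: second_moment_law Q by (rule Q_mem)
  interpret P: second_moment_law P using P by (simp add: P2_iff)
  let ?I = "interior (measure_support Q)"
  interpret monotone_transport P Q ?I
  proof
    show "isCont (cdf P) x" for x by (rule P.has_density_isCont_cdf[OF p(1)])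
    show "isCont (cdf Q) x" for x by (rule Q.has_density_isCont_cdf[OF q(1)])
    show "strict_mono (cdf P)" using p(1,3) by (rule P.has_density_strict_mono_cdf)
    show "is_interval ?I"
      using supp by (simp add: is_interval_convex_1 convex_interior)
    show "AE y in Q. y \<in> ?I" using q(1) supp by (rule Q.AE_interior_measure_support)
    show "cdf Q a < cdf Q b" if "a \<in> ?I" "a < b" for a b
      using that Q.has_density_isCont_cdf[OF q(1)] by (rule Q.cdf_less_support)
  qed simp
  have T_eq: "T = monotone_transport.T P Q"
    unfolding T using T_def by (simp add: fun_eq_iff)
  have EL: "2 * k\<^sup>2 * (y - T y) + Q.risk' y = 0" if "y \<in> ?I" for y
    unfolding T_eq using k min that by (rule euler_lagrange)
  \<comment> \<open>Full support extends the Euler--Lagrange equation to the whole line, so that all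
    three assertions about \<Lambda> follow from one identity valid at every point.\<close>
  have I: "?I = UNIV"
    using k EL unfolding T_eq by (rule I_eq_UNIV)
  have EL: "2 * k\<^sup>2 * (y - T y) + Q.risk' y = 0" for y
    using EL by (simp add: I)
  obtain l where l: "\<And>y. ereal (2 * k\<^sup>2) * \<phi> y + ereal (Q.risk y) = ereal l"
    using potential_plus_risk_constant[OF k I EL[unfolded T_eq] \<phi>] by blast
  have quad: "(\<lambda>y. y\<^sup>2 - 2 * y * a y + b y) = Q.risk"
    unfolding a b by (rule ext) (rule Q.quadratic_eq_risk[OF m])
  have s_eq: "s = Q.score" unfolding s pZ by (rule Q.deriv_ln_conv_measure)
  have conv: "conv_fun (\<lambda>z. 2 * deriv s z + (s z)\<^sup>2) = (\<lambda>y. Q.risk y - 1)"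
    unfolding s_eq Q.deriv_score by (rule ext) (rule Q.conv_fun_eq_risk)
  have D1: "(Q.risk has_real_derivative Q.risk' y) (at y)" for y
    by (rule Q.DERIV_risk)
  have D2: "((\<lambda>y. Q.risk y - 1) has_real_derivative Q.risk' y) (at y)" for y
    using DERIV_diff[OF D1 DERIV_const] by simp
  have "\<Lambda> y = ereal l" for y
    unfolding \<Lambda> fun_cong[OF quad] by (rule l)
  moreover have "Q.risk differentiable (at y)" "(\<lambda>y. Q.risk y - 1) differentiable (at y)" for y
    using D1 D2 real_differentiable_def by blast+
  ultimately show ?thesis
    unfolding conv quad
    using EL DERIV_imp_deriv[OF D1] DERIV_imp_deriv[OF D2]
    by (intro exI[of _ l]) auto
qed

end
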